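(* An $EMV$-algebra $(M;\vee,\wedge,\oplus,0)$ is semisimple if and only if $M$ is isomorphic to an $EMV$-clan of fuzzy functions on some $\Omega\neq\emptyset$.
   Context: An $MV$-algebra is an algebra $(A;\oplus,',0,1)$ of type $(2,1,0,0)$ such that $(A;\oplus,0)$ is a commutative monoid and, for all $x,y\in A$, $x''=x$, $x\oplus 1=1$ and $x\oplus(x\oplus y')'=y\oplus(y\oplus x')'$. An algebra $(M;\vee,\wedge,\oplus,0)$ of type $(2,2,2,0)$ is an $EMV$-algebra if: (1) $(M;\vee,\wedge,0)$ is a distributive lattice with least element $0$; (2) $(M;\oplus,0)$ is a commutative ordered monoid with neutral element $0$; (3) writing $\mathcal I(M)=\{a\in M: a\oplus a=a\}$, for all $a\le b$ in $\mathcal I(M)$ and all $x\in[a,b]$ the element $\lambda_{a,b}(x)=\min\{z\in[a,b]: x\oplus z=b\}$ exists in $M$, and $([a,b];\oplus,\lambda_{a,b},a,b)$ is an $MV$-algebra; (4) each $x\in M$ lies below some $a\in\mathcal I(M)$. We write $\lambda_b:=\lambda_{0,b}$. An $EMV$-homomorphism is a map $f$ preserving $\vee,\wedge,\oplus,0$ with $f(\lambda_b(x))=\lambda_{f(b)}(f(x))$ for all idempotents $b$ and all $x\in[0,b]$; an isomorphism is a bijective $EMV$-homomorphism. An ideal of $M$ is a non-empty down-closed subset closed under $\oplus$; it is maximal if it is proper (different from $M$) and for every $x\in M\setminus I$ the least ideal containing $I\cup\{x\}$ is $M$. $M$ is semisimple if the intersection of all maximal ideals of $M$ equals $\{0\}$.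 A system $\mathcal T\subseteq[0,1]^\Omega$ of fuzzy sets of a set $\Omega\ne\emptyset$ is an $EMV$-clan if (i) $0_\Omega\in\mathcal T$, where $0_\Omega(\omega)=0$ for each $\omega\in\Omega$; (ii) if $a\in\mathcal T$ is a characteristic function, then (a) $a-f\in\mathcal T$ for each $f\in\mathcal T$ with $f(\omega)\le a(\omega)$ for each $\omega\in\Omega$, and (b) if $f,g\in\mathcal T$ with $f(\omega),g(\omega)\le a(\omega)$ for each $\omega\in\Omega$, then $f\oplus g\in\mathcal T$, where $(f\oplus g)(\omega)=\min\{f(\omega)+g(\omega),a(\omega)\}$ for $\omega\in\Omega$; (iii) for each $f\in\mathcal T$ there is a characteristic function $a\in\mathcal T$ such that $f(\omega)\le a(\omega)$ for each $\omega\in\Omega$; (iv) given $\omega\in\Omega$, there is $f\in\mathcal T$ such that $f(\omega)=1$. An $EMV$-clan is regarded as an $EMV$-algebra of fuzzy sets with all operations defined pointwise: $\vee=\max$, $\wedge=\min$, $\oplus$ as in (b), and least element $0_\Omega$. *)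

theory Defs
  imports Complex_Main "HOL-Library.FuncSet" "HOL-Algebra.Group"
begin

locale mv_algebra =
  fixes A :: "'a set" and plus :: "'a \<Rightarrow> 'a \<Rightarrow> 'a" and neg :: "'a \<Rightarrow> 'a" and zero one :: 'a
  assumes comm_monoid: "comm_monoid \<lparr>carrier = A, mult = plus, one = zero\<rparr>"
    and neg_closed: "x \<in> A \<Longrightarrow> neg x \<in> A"
    and one_closed: "one \<in> A"
    and neg_neg: "x \<in> A \<Longrightarrow> neg (neg x) = x"
    and plus_one: "x \<in> A \<Longrightarrow> plus x one = one"
    and lukasiewicz: "\<lbrakk>x \<in> A; y \<in> A\<rbrakk> \<Longrightarrow>
      plus x (neg (plus x (neg y))) = plus y (neg (plus y (neg x)))"

record 'a emv = "'a partial_object" +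
  vee :: "'a \<Rightarrow> 'a \<Rightarrow> 'a" (infixl \<open>\<curlyvee>\<index>\<close> 65)
  wedge :: "'a \<Rightarrow> 'a \<Rightarrow> 'a" (infixl \<open>\<curlywedge>\<index>\<close> 70)
  oplus :: "'a \<Rightarrow> 'a \<Rightarrow> 'a" (infixl \<open>\<oplus>\<index>\<close> 65)
  bottom :: 'a (\<open>\<zero>\<index>\<close>)

definition emv_le :: "'a emv \<Rightarrow> 'a \<Rightarrow> 'a \<Rightarrow> bool" (infix \<open>\<preceq>\<index>\<close> 50)
  where "x \<preceq>\<^bsub>M\<^esub> y \<longleftrightarrow> x \<curlywedge>\<^bsub>M\<^esub> y = x"

definition idempotents :: "'a emv \<Rightarrow> 'a set"
  where "idempotents M = {a \<in> carrier M. a \<oplus>\<^bsub>M\<^esub> a = a}"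

definition emv_interval :: "'a emv \<Rightarrow> 'a \<Rightarrow> 'a \<Rightarrow> 'a set"
  where "emv_interval M a b = {x \<in> carrier M. a \<preceq>\<^bsub>M\<^esub> x \<and> x \<preceq>\<^bsub>M\<^esub> b}"

definition is_emv_min :: "'a emv \<Rightarrow> 'a set \<Rightarrow> 'a \<Rightarrow> bool"
  where "is_emv_min M Z z \<longleftrightarrow> z \<in> Z \<and> (\<forall>w\<in>Z. z \<preceq>\<^bsub>M\<^esub> w)"

definition emv_complements :: "'a emv \<Rightarrow> 'a \<Rightarrow> 'a \<Rightarrow> 'a \<Rightarrow> 'a set"
  where "emv_complements M a b x = {z \<in> emv_interval M a b. x \<oplus>\<^bsub>M\<^esub> z = b}"

text \<open>\<open>emv_lambda M a b x\<close> is \<open>\<lambda>\<^sub>a\<^sub>,\<^sub>b(x)\<close>; it is meaningful only if the minimum exists.\<close>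

definition emv_lambda :: "'a emv \<Rightarrow> 'a \<Rightarrow> 'a \<Rightarrow> 'a \<Rightarrow> 'a"
  where "emv_lambda M a b x = (THE z. is_emv_min M (emv_complements M a b x) z)"

locale emv_algebra =
  fixes M :: "'a emv" (structure)
  assumes vee_closed: "\<lbrakk>x \<in> carrier M; y \<in> carrier M\<rbrakk> \<Longrightarrow> x \<curlyvee> y \<in> carrier M"
    and wedge_closed: "\<lbrakk>x \<in> carrier M; y \<in> carrier M\<rbrakk> \<Longrightarrow> x \<curlywedge> y \<in> carrier M"
    and vee_comm: "\<lbrakk>x \<in> carrier M; y \<in> carrier M\<rbrakk> \<Longrightarrow> x \<curlyvee> y = y \<curlyvee> x"
    and wedge_comm: "\<lbrakk>x \<in> carrier M; y \<in> carrier M\<rbrakk> \<Longrightarrow> x \<curlywedge> y = y \<curlywedge> x"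
    and vee_assoc: "\<lbrakk>x \<in> carrier M; y \<in> carrier M; z \<in> carrier M\<rbrakk> \<Longrightarrow>
      (x \<curlyvee> y) \<curlyvee> z = x \<curlyvee> (y \<curlyvee> z)"
    and wedge_assoc: "\<lbrakk>x \<in> carrier M; y \<in> carrier M; z \<in> carrier M\<rbrakk> \<Longrightarrow>
      (x \<curlywedge> y) \<curlywedge> z = x \<curlywedge> (y \<curlywedge> z)"
    and vee_absorb: "\<lbrakk>x \<in> carrier M; y \<in> carrier M\<rbrakk> \<Longrightarrow> x \<curlyvee> (x \<curlywedge> y) = x"
    and wedge_absorb: "\<lbrakk>x \<in> carrier M; y \<in> carrier M\<rbrakk> \<Longrightarrow> x \<curlywedge> (x \<curlyvee> y) = x"
    and distrib: "\<lbrakk>x \<in> carrier M; y \<in> carrier M; z \<in> carrier M\<rbrakk> \<Longrightarrow>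
      x \<curlywedge> (y \<curlyvee> z) = (x \<curlywedge> y) \<curlyvee> (x \<curlywedge> z)"
    and bot_least: "x \<in> carrier M \<Longrightarrow> \<zero> \<preceq> x"
    and comm_monoid: "comm_monoid \<lparr>carrier = carrier M, mult = (\<oplus>), one = \<zero>\<rparr>"
    and oplus_mono: "\<lbrakk>x \<in> carrier M; y \<in> carrier M; z \<in> carrier M; x \<preceq> y\<rbrakk> \<Longrightarrow>
      x \<oplus> z \<preceq> y \<oplus> z"
    and lambda_exists: "\<lbrakk>a \<in> idempotents M; b \<in> idempotents M; a \<preceq> b; x \<in> emv_interval M a b\<rbrakk> \<Longrightarrow>
      \<exists>z. is_emv_min M (emv_complements M a b x) z"
    and interval_mv: "\<lbrakk>a \<in> idempotents M; b \<in> idempotents M; a \<preceq> b\<rbrakk> \<Longrightarrow>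
      mv_algebra (emv_interval M a b) (\<oplus>) (emv_lambda M a b) a b"
    and below_idempotent: "x \<in> carrier M \<Longrightarrow> \<exists>a\<in>idempotents M. x \<preceq> a"

definition emv_hom :: "'a emv \<Rightarrow> 'b emv \<Rightarrow> ('a \<Rightarrow> 'b) set"
  where "emv_hom M N = {f \<in> carrier M \<rightarrow> carrier N.
    (\<forall>x\<in>carrier M. \<forall>y\<in>carrier M.
      f (x \<curlyvee>\<^bsub>M\<^esub> y) = f x \<curlyvee>\<^bsub>N\<^esub> f y \<and>
      f (x \<curlywedge>\<^bsub>M\<^esub> y) = f x \<curlywedge>\<^bsub>N\<^esub> f y \<and>
      f (x \<oplus>\<^bsub>M\<^esub> y) = f x \<oplus>\<^bsub>N\<^esub> f y) \<and>
    f \<zero>\<^bsub>M\<^esub> = \<zero>\<^bsub>N\<^esub> \<and>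
    (\<forall>b\<in>idempotents M. \<forall>x\<in>emv_interval M \<zero>\<^bsub>M\<^esub> b.
      f (emv_lambda M \<zero>\<^bsub>M\<^esub> b x) = emv_lambda N \<zero>\<^bsub>N\<^esub> (f b) (f x))}"

definition emv_isomorphic :: "'a emv \<Rightarrow> 'b emv \<Rightarrow> bool"
  where "emv_isomorphic M N \<longleftrightarrow> (\<exists>f\<in>emv_hom M N. bij_betw f (carrier M) (carrier N))"

definition emv_ideal :: "'a emv \<Rightarrow> 'a set \<Rightarrow> bool"
  where "emv_ideal M I \<longleftrightarrow> I \<noteq> {} \<and> I \<subseteq> carrier M \<and>
    (\<forall>x\<in>I. \<forall>y\<in>carrier M. y \<preceq>\<^bsub>M\<^esub> x \<longrightarrow> y \<in> I) \<and>
    (\<forall>x\<in>I. \<forall>y\<in>I. x \<oplus>\<^bsub>M\<^esub> y \<in> I)"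

definition generated_ideal :: "'a emv \<Rightarrow> 'a set \<Rightarrow> 'a set"
  where "generated_ideal M S = \<Inter>{J. emv_ideal M J \<and> S \<subseteq> J}"

definition maximal_emv_ideal :: "'a emv \<Rightarrow> 'a set \<Rightarrow> bool"
  where "maximal_emv_ideal M I \<longleftrightarrow> emv_ideal M I \<and> I \<noteq> carrier M \<and>
    (\<forall>x\<in>carrier M - I. generated_ideal M (I \<union> {x}) = carrier M)"

text \<open>The intersection is taken of a non-empty family. For an algebra with more than one element
  this excludes nothing that the convention \<open>\<Inter>{} = carrier M\<close> would admit. The one-element algebra
  has no maximal ideals and is thereby not semisimple, in accordance with the fact that an EMV-clan
  on a non-empty set has at least two elements.\<close>

definition semisimple :: "'a emv \<Rightarrow> bool"
  where "semisimple M \<longleftrightarrow> {I. maximal_emv_ideal M I} \<noteq> {} \<and>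
    \<Inter>{I. maximal_emv_ideal M I} = {\<zero>\<^bsub>M\<^esub>}"

text \<open>Functions on \<open>\<Omega>\<close> are represented extensionally (undefined outside \<open>\<Omega>\<close>), so that
  HOL equality of members of \<open>\<Omega> \<rightarrow>\<^sub>E {0..1}\<close> is equality of functions on \<open>\<Omega>\<close>.\<close>

definition characteristic_fun :: "'w set \<Rightarrow> ('w \<Rightarrow> real) \<Rightarrow> bool"
  where "characteristic_fun \<Omega> a \<longleftrightarrow> (\<exists>A\<subseteq>\<Omega>. a = (\<lambda>\<omega>\<in>\<Omega>. if \<omega> \<in> A then 1 else 0))"

locale emv_clan =
  fixes \<Omega> :: "'w set" and T :: "('w \<Rightarrow> real) set"
  assumes nonempty: "\<Omega> \<noteq> {}"
    and fuzzy: "T \<subseteq> \<Omega> \<rightarrow>\<^sub>E {0..1}"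
    and zero: "(\<lambda>\<omega>\<in>\<Omega>. 0) \<in> T"
    and diff: "\<lbrakk>a \<in> T; characteristic_fun \<Omega> a; f \<in> T; \<forall>\<omega>\<in>\<Omega>. f \<omega> \<le> a \<omega>\<rbrakk> \<Longrightarrow>
      (\<lambda>\<omega>\<in>\<Omega>. a \<omega> - f \<omega>) \<in> T"
    and plus: "\<lbrakk>a \<in> T; characteristic_fun \<Omega> a; f \<in> T; g \<in> T;
      \<forall>\<omega>\<in>\<Omega>. f \<omega> \<le> a \<omega> \<and> g \<omega> \<le> a \<omega>\<rbrakk> \<Longrightarrow> (\<lambda>\<omega>\<in>\<Omega>. min (f \<omega> + g \<omega>) (a \<omega>)) \<in> T"
    and dominated: "f \<in> T \<Longrightarrow> \<exists>a\<in>T. characteristic_fun \<Omega> a \<and> (\<forall>\<omega>\<in>\<Omega>. f \<omega> \<le> a \<omega>)"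
    and full: "\<omega> \<in> \<Omega> \<Longrightarrow> \<exists>f\<in>T. f \<omega> = 1"

text \<open>For every characteristic function \<open>a\<close> above \<open>f\<close> and \<open>g\<close> we have
  \<open>min (f \<omega> + g \<omega>) (a \<omega>) = min (f \<omega> + g \<omega>) 1\<close>, since both \<open>f\<close> and \<open>g\<close> vanish where \<open>a\<close> does;
  so the sum does not depend on the choice of \<open>a\<close>. The clan axioms alone do not make \<open>T\<close> closed
  under the pointwise maximum or under sums of functions without a common bound \<open>a\<close>
  (for instance \<open>T = {0, \<chi>\<^sub>1, \<chi>\<^sub>2}\<close> on a two-point set), but an isomorphism from
  an EMV-algebra onto \<open>clan_algebra \<Omega> T\<close> does.\<close>

definition clan_algebra :: "'w set \<Rightarrow> ('w \<Rightarrow> real) set \<Rightarrow> ('w \<Rightarrow> real) emv"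
  where "clan_algebra \<Omega> T = \<lparr>carrier = T,
    vee = (\<lambda>f g. \<lambda>\<omega>\<in>\<Omega>. max (f \<omega>) (g \<omega>)),
    wedge = (\<lambda>f g. \<lambda>\<omega>\<in>\<Omega>. min (f \<omega>) (g \<omega>)),
    oplus = (\<lambda>f g. \<lambda>\<omega>\<in>\<Omega>. min (f \<omega> + g \<omega>) 1),
    bottom = (\<lambda>\<omega>\<in>\<Omega>. 0)\<rparr>"

end

theory Submission
  imports Defs
begin

text \<open>Below any finite set of elements there is an MV-algebra \<open>[0, b]\<close>, and the truncated difference
  \<open>x \<odot> y'\<close> computed there does not depend on \<open>b\<close>. So an EMV-algebra carries the
  structure of a (dual) Wajsberg hoop in which every element lies below an idempotent. Its
  quotient by a maximal ideal \<open>I\<close> is a simple chain; all idempotents outside \<open>I\<close> become its top element. Chang's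
  construction turns the truncated sum on this chain into the commutative monoid of sums with
  carry. The number of carries is a quasi-morphism, and homogenizing it yields an additive map,
  hence a \<open>[0, 1]\<close>-valued homomorphism with kernel \<open>I\<close>. Evaluating at all maximal ideals embeds a
  semisimple algebra as an EMV-clan. Conversely, the points of a clan define maximal ideals whose
  intersection is zero.\<close>

section \<open>Dual Wajsberg hoops\<close>

text \<open>An EMV-algebra may lack a top element, and its complements depend on a bound; a hoop
  asks for neither. The hoop axioms are equations in at most three variables, so they can be checked
  in one bounded interval and pass to quotients. Here \<open>sup_comm\<close> is the divisibility
  law of hoops and \<open>inf_comm\<close> is Wajsberg's law; their sides are the join and the meet.
  Maximality of an ideal is used twice: it makes the ideal prime, so that the quotient is a chain,
  and it identifies the kernel of the finished homomorphism with the ideal. In between, every chain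
  with a top is treated alike, without an archimedean property or Hoelder's theorem: infinitesimal
  elements, if there are any, are sent to 0 by the limit. Chang's ordered group is replaced by its
  positive cone, so integer parts are natural numbers and multiples are powers in a commutative
  monoid.\<close>

locale dual_wajsberg_hoop =
  fixes A :: "'a set"
    and plus :: "'a \<Rightarrow> 'a \<Rightarrow> 'a" (infixl \<open>\<boxplus>\<close> 65)
    and minus :: "'a \<Rightarrow> 'a \<Rightarrow> 'a" (infixl \<open>\<boxminus>\<close> 65)
    and zero :: 'a (\<open>\<bottom>\<close>)
  assumes zero_closed [simp, intro]: "\<bottom> \<in> A"
    and plus_closed [simp, intro]: "\<lbrakk>x \<in> A; y \<in> A\<rbrakk> \<Longrightarrow> x \<boxplus> y \<in> A"
    and minus_closed [simp, intro]: "\<lbrakk>x \<in> A; y \<in> A\<rbrakk> \<Longrightarrow> x \<boxminus> y \<in> A"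
    and plus_assoc: "\<lbrakk>x \<in> A; y \<in> A; z \<in> A\<rbrakk> \<Longrightarrow> (x \<boxplus> y) \<boxplus> z = x \<boxplus> (y \<boxplus> z)"
    and plus_comm: "\<lbrakk>x \<in> A; y \<in> A\<rbrakk> \<Longrightarrow> x \<boxplus> y = y \<boxplus> x"
    and plus_zero [simp]: "x \<in> A \<Longrightarrow> x \<boxplus> \<bottom> = x"
    and minus_self [simp]: "x \<in> A \<Longrightarrow> x \<boxminus> x = \<bottom>"
    and zero_minus [simp]: "x \<in> A \<Longrightarrow> \<bottom> \<boxminus> x = \<bottom>"
    and minus_plus: "\<lbrakk>x \<in> A; y \<in> A; z \<in> A\<rbrakk> \<Longrightarrow> x \<boxminus> (y \<boxplus> z) = (x \<boxminus> y) \<boxminus> z"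
    and sup_comm: "\<lbrakk>x \<in> A; y \<in> A\<rbrakk> \<Longrightarrow> (x \<boxminus> y) \<boxplus> y = (y \<boxminus> x) \<boxplus> x"
    and inf_comm: "\<lbrakk>x \<in> A; y \<in> A\<rbrakk> \<Longrightarrow> x \<boxminus> (x \<boxminus> y) = y \<boxminus> (y \<boxminus> x)"
begin

definition le :: "'a \<Rightarrow> 'a \<Rightarrow> bool" (infix \<open>\<sqsubseteq>\<close> 50)
  where "x \<sqsubseteq> y \<longleftrightarrow> x \<boxminus> y = \<bottom>"

definition ideal :: "'a set \<Rightarrow> bool"
  where "ideal I \<longleftrightarrow> \<bottom> \<in> I \<and> I \<subseteq> A \<and> (\<forall>x\<in>I. \<forall>y\<in>A. y \<sqsubseteq> x \<longrightarrow> y \<in> I) \<and>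
    (\<forall>x\<in>I. \<forall>y\<in>I. x \<boxplus> y \<in> I)"

definition maximal_ideal :: "'a set \<Rightarrow> bool"
  where "maximal_ideal I \<longleftrightarrow> ideal I \<and> I \<noteq> A \<and>
    (\<forall>J. ideal J \<longrightarrow> I \<subseteq> J \<longrightarrow> J = I \<or> J = A)"

section \<open>Order, residuation and lattice terms of a hoop\<close>

lemma zero_plus [simp]: "x \<in> A \<Longrightarrow> \<bottom> \<boxplus> x = x"
  using plus_comm plus_zero zero_closed by metis

lemma plus_lcomm: "\<lbrakk>x \<in> A; y \<in> A; z \<in> A\<rbrakk> \<Longrightarrow> x \<boxplus> (y \<boxplus> z) = y \<boxplus> (x \<boxplus> z)"
  by (metis plus_assoc plus_comm)

lemmas plus_ac = plus_assoc plus_comm plus_lcomm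

lemma minus_zero [simp]: "x \<in> A \<Longrightarrow> x \<boxminus> \<bottom> = x"
  using sup_comm[of x \<bottom>] by simp

lemma minus_minus_comm: "\<lbrakk>x \<in> A; y \<in> A; z \<in> A\<rbrakk> \<Longrightarrow> (x \<boxminus> y) \<boxminus> z = (x \<boxminus> z) \<boxminus> y"
  by (metis minus_plus plus_comm)

lemma le_refl [simp]: "x \<in> A \<Longrightarrow> x \<sqsubseteq> x"
  by (simp add: le_def)

lemma le_antisym: "\<lbrakk>x \<sqsubseteq> y; y \<sqsubseteq> x; x \<in> A; y \<in> A\<rbrakk> \<Longrightarrow> x = y"
  using sup_comm[of x y] by (simp add: le_def)

lemma residuation: "\<lbrakk>x \<in> A; y \<in> A; z \<in> A\<rbrakk> \<Longrightarrow> x \<boxminus> y \<sqsubseteq> z \<longleftrightarrow> x \<sqsubseteq> y \<boxplus> z"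
  by (simp add: le_def minus_plus)

lemma le_plus [simp]: "\<lbrakk>x \<in> A; y \<in> A\<rbrakk> \<Longrightarrow> x \<sqsubseteq> x \<boxplus> y"
  by (simp add: le_def minus_plus)

lemma le_plus2 [simp]: "\<lbrakk>x \<in> A; y \<in> A\<rbrakk> \<Longrightarrow> x \<sqsubseteq> y \<boxplus> x"
  by (metis le_plus plus_comm)

lemma minus_add: "\<lbrakk>x \<sqsubseteq> y; x \<in> A; y \<in> A\<rbrakk> \<Longrightarrow> (y \<boxminus> x) \<boxplus> x = y"
  using sup_comm[of y x] by (simp add: le_def)

lemma add_minus: "\<lbrakk>x \<sqsubseteq> y; x \<in> A; y \<in> A\<rbrakk> \<Longrightarrow> x \<boxplus> (y \<boxminus> x) = y"
  using minus_add plus_comm by auto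

lemma le_iff_plus: "\<lbrakk>x \<in> A; y \<in> A\<rbrakk> \<Longrightarrow> x \<sqsubseteq> y \<longleftrightarrow> (\<exists>w\<in>A. y = x \<boxplus> w)"
  by (metis le_plus add_minus minus_closed)

lemma le_trans [trans]: "\<lbrakk>x \<sqsubseteq> y; y \<sqsubseteq> z; x \<in> A; y \<in> A; z \<in> A\<rbrakk> \<Longrightarrow> x \<sqsubseteq> z"
  by (metis le_iff_plus plus_assoc plus_closed)

lemma minus_le [simp]: "\<lbrakk>x \<in> A; y \<in> A\<rbrakk> \<Longrightarrow> x \<boxminus> y \<sqsubseteq> x"
  by (simp add: residuation)

lemma zero_le [simp]: "x \<in> A \<Longrightarrow> \<bottom> \<sqsubseteq> x"
  by (simp add: le_def)

lemma plus_mono: "\<lbrakk>x \<sqsubseteq> y; z \<sqsubseteq> w; x \<in> A; y \<in> A; z \<in> A; w \<in> A\<rbrakk> \<Longrightarrow> x \<boxplus> z \<sqsubseteq> y \<boxplus> w"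
proof -
  assume a: "x \<sqsubseteq> y" "z \<sqsubseteq> w" and A: "x \<in> A" "y \<in> A" "z \<in> A" "w \<in> A"
  then obtain u v where "u \<in> A" "y = x \<boxplus> u" "v \<in> A" "w = z \<boxplus> v"
    using le_iff_plus by meson
  then have "y \<boxplus> w = (x \<boxplus> z) \<boxplus> (u \<boxplus> v)" using A by (simp add: plus_ac)
  then show ?thesis using A \<open>u \<in> A\<close> \<open>v \<in> A\<close> by simp
qed

lemma le_minus_add: "\<lbrakk>x \<in> A; y \<in> A\<rbrakk> \<Longrightarrow> x \<sqsubseteq> y \<boxplus> (x \<boxminus> y)"
  using residuation[of x y "x \<boxminus> y"] by simp

lemma minus_mono: "\<lbrakk>x \<sqsubseteq> y; x \<in> A; y \<in> A; z \<in> A\<rbrakk> \<Longrightarrow> x \<boxminus> z \<sqsubseteq> y \<boxminus> z"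
  by (meson le_minus_add le_trans minus_closed plus_closed residuation)

lemma minus_antimono: "\<lbrakk>x \<sqsubseteq> y; x \<in> A; y \<in> A; z \<in> A\<rbrakk> \<Longrightarrow> z \<boxminus> y \<sqsubseteq> z \<boxminus> x"
  by (metis le_iff_plus minus_closed minus_le minus_plus)

lemma minus_minus_le: "\<lbrakk>x \<in> A; y \<in> A\<rbrakk> \<Longrightarrow> x \<boxminus> (x \<boxminus> y) \<sqsubseteq> y"
  by (simp add: inf_comm[of x y])

lemma minus_minus_self: "\<lbrakk>y \<sqsubseteq> x; x \<in> A; y \<in> A\<rbrakk> \<Longrightarrow> x \<boxminus> (x \<boxminus> y) = y"
  by (simp add: inf_comm[of x y] le_def)

lemma inf_greatest: "\<lbrakk>z \<sqsubseteq> x; z \<sqsubseteq> y; x \<in> A; y \<in> A; z \<in> A\<rbrakk> \<Longrightarrow> z \<sqsubseteq> x \<boxminus> (x \<boxminus> y)"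
  by (metis minus_antimono minus_closed minus_minus_self)

lemma sup_least: "\<lbrakk>x \<sqsubseteq> z; y \<sqsubseteq> z; x \<in> A; y \<in> A; z \<in> A\<rbrakk> \<Longrightarrow> (x \<boxminus> y) \<boxplus> y \<sqsubseteq> z"
  by (metis le_refl minus_add minus_closed minus_mono plus_mono)

lemma minus_minus_minus: "\<lbrakk>x \<in> A; y \<in> A\<rbrakk> \<Longrightarrow> x \<boxminus> (x \<boxminus> (x \<boxminus> y)) = x \<boxminus> y"
  by (simp add: minus_minus_self)

text \<open>The common part \<open>d\<close> of both differences can be added to the meet
  \<open>m\<close> without exceeding \<open>x\<close> or \<open>y\<close>, so \<open>m\<close>
  absorbs \<open>d\<close>. Removing \<open>d\<close> from \<open>x \<boxminus> y\<close> therefore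
  changes nothing, which forces \<open>d = \<bottom>\<close>.\<close>

lemma prelinear:
  assumes [simp]: "x \<in> A" "y \<in> A"
  shows "(x \<boxminus> y) \<boxminus> ((x \<boxminus> y) \<boxminus> (y \<boxminus> x)) = \<bottom>"
proof -
  define m where "m = x \<boxminus> (x \<boxminus> y)"
  define d where "d = (x \<boxminus> y) \<boxminus> ((x \<boxminus> y) \<boxminus> (y \<boxminus> x))"
  define p where "p = (x \<boxminus> y) \<boxminus> d"
  have [simp]: "m \<in> A" "d \<in> A" "p \<in> A" by (simp_all add: m_def d_def p_def)
  have my: "m = y \<boxminus> (y \<boxminus> x)" by (simp add: m_def inf_comm)
  have xm: "x \<boxminus> m = x \<boxminus> y" "y \<boxminus> m = y \<boxminus> x"
    using minus_minus_minus by (simp add: m_def, simp add: my)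
  have mx: "m \<sqsubseteq> x" "m \<sqsubseteq> y" by (simp add: m_def, simp add: my)
  have x: "x = m \<boxplus> (x \<boxminus> y)" and y: "y = m \<boxplus> (y \<boxminus> x)"
    using add_minus[OF mx(1)] add_minus[OF mx(2)] xm by simp_all
  have d: "d \<sqsubseteq> x \<boxminus> y" "d \<sqsubseteq> y \<boxminus> x" by (simp_all add: d_def minus_minus_le)
  have "m \<boxplus> d \<sqsubseteq> x" using plus_mono[OF le_refl[of m] d(1)] x by simp
  moreover have "m \<boxplus> d \<sqsubseteq> y" using plus_mono[OF le_refl[of m] d(2)] y by simp
  ultimately have "m \<boxplus> d \<sqsubseteq> m" using inf_greatest[of "m \<boxplus> d" x y] by (simp add: m_def)
  then have md: "m \<boxplus> d = m" by (simp add: le_antisym)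
  have "x \<boxminus> y = d \<boxplus> p" using add_minus[OF d(1)] by (simp add: p_def)
  then have "x = m \<boxplus> p" using x md by (metis \<open>d \<in> A\<close> \<open>m \<in> A\<close> \<open>p \<in> A\<close> plus_assoc)
  then have "x \<boxminus> m \<sqsubseteq> p" by (simp add: residuation)
  then have "p = x \<boxminus> y" using xm by (simp add: p_def le_antisym)
  then have "(x \<boxminus> y) \<boxminus> d = x \<boxminus> y" by (simp add: p_def)
  then have "d = \<bottom>" using d minus_minus_self[of d "x \<boxminus> y"] by simp
  then show ?thesis by (simp add: d_def)
qed

text \<open>Riesz decomposition: an element \<open>d\<close> below \<open>y \<boxplus> z\<close>
  splits into its meet with \<open>y\<close> and the rest \<open>d \<boxminus> y\<close>, which
  residuation puts below \<open>z\<close>. If \<open>d\<close> lies below \<open>q\<close>, so do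
  both pieces.\<close>

lemma inf_plus_le:
  assumes [simp]: "q \<in> A" "y \<in> A" "z \<in> A"
  shows "q \<boxminus> (q \<boxminus> (y \<boxplus> z)) \<sqsubseteq> (q \<boxminus> (q \<boxminus> y)) \<boxplus> (q \<boxminus> (q \<boxminus> z))"
proof -
  define d where "d = q \<boxminus> (q \<boxminus> (y \<boxplus> z))"
  have [simp]: "d \<in> A" by (simp add: d_def)
  have d: "d \<sqsubseteq> q" "d \<sqsubseteq> y \<boxplus> z" by (simp_all add: d_def minus_minus_le)
  define e where "e = d \<boxminus> (d \<boxminus> y)"
  have [simp]: "e \<in> A" by (simp add: e_def)
  have "e \<sqsubseteq> d" "e \<sqsubseteq> y" by (simp_all add: e_def minus_minus_le)
  then have e: "e \<sqsubseteq> q \<boxminus> (q \<boxminus> y)" using d inf_greatest le_trans[of e d q] by simp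
  have "d \<boxminus> y \<sqsubseteq> z" using d by (simp add: residuation)
  moreover have "d \<boxminus> y \<sqsubseteq> q" using d le_trans[of "d \<boxminus> y" d q] by simp
  ultimately have dy: "d \<boxminus> y \<sqsubseteq> q \<boxminus> (q \<boxminus> z)" by (simp add: inf_greatest)
  have "d = e \<boxplus> (d \<boxminus> y)" by (simp add: e_def minus_add)
  then show ?thesis using plus_mono[OF e dy] by (simp add: d_def)
qed

section \<open>Ideals and primeness of maximal ideals\<close>

lemma ideal_zero: "ideal I \<Longrightarrow> \<bottom> \<in> I"
  and ideal_subset: "ideal I \<Longrightarrow> I \<subseteq> A"
  and ideal_down: "\<lbrakk>ideal I; x \<in> I; y \<sqsubseteq> x; y \<in> A\<rbrakk> \<Longrightarrow> y \<in> I"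
  and ideal_plus: "\<lbrakk>ideal I; x \<in> I; y \<in> I\<rbrakk> \<Longrightarrow> x \<boxplus> y \<in> I"
  unfolding ideal_def by blast+

lemma maximal_ideal_ideal: "maximal_ideal I \<Longrightarrow> ideal I"
  by (simp add: maximal_ideal_def)

text \<open>The elements whose meet with \<open>q\<close> lies in \<open>I\<close> form an ideal
  \<open>J\<close>, by \<open>inf_plus_le\<close>. It contains \<open>I\<close> and
  \<open>p\<close>; if \<open>p\<close> is outside \<open>I\<close>, then \<open>J\<close> is
  everything and contains \<open>q\<close>, whose meet with itself is \<open>q\<close>.\<close>

lemma maximal_ideal_prime:
  assumes I: "maximal_ideal I" and [simp]: "p \<in> A" "q \<in> A"
    and pq: "p \<boxminus> (p \<boxminus> q) = \<bottom>"
  shows "p \<in> I \<or> q \<in> I"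
proof (rule ccontr)
  assume n: "\<not> (p \<in> I \<or> q \<in> I)"
  have iI: "ideal I" using I maximal_ideal_ideal by simp
  define J where "J = {z \<in> A. q \<boxminus> (q \<boxminus> z) \<in> I}"
  have IJ: "I \<subseteq> J"
  proof
    fix x assume x: "x \<in> I"
    then have "x \<in> A" using ideal_subset[OF iI] by blast
    then show "x \<in> J" using ideal_down[OF iI x minus_minus_le] by (simp add: J_def)
  qed
  have "ideal J"
    unfolding ideal_def
  proof (intro conjI ballI impI)
    show "\<bottom> \<in> J" using iI by (simp add: J_def ideal_def)
    show "J \<subseteq> A" by (auto simp: J_def)
    fix x y assume x: "x \<in> J"
    { assume y: "y \<in> A" "y \<sqsubseteq> x"
      then have "q \<boxminus> (q \<boxminus> y) \<sqsubseteq> q \<boxminus> (q \<boxminus> x)" using x by (simp add: J_def minus_antimono)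
      then show "y \<in> J" using x y ideal_down[OF iI, of "q \<boxminus> (q \<boxminus> x)" "q \<boxminus> (q \<boxminus> y)"]
        by (simp add: J_def) }
    { assume y: "y \<in> J"
      then show "x \<boxplus> y \<in> J" using x ideal_down[OF iI ideal_plus[OF iI] inf_plus_le[of q x y]]
        by (simp add: J_def) }
  qed
  moreover have "p \<in> J"
    using iI pq by (simp add: J_def inf_comm[of q p] ideal_def)
  ultimately have "J = A" using I IJ n by (auto simp: maximal_ideal_def)
  then have "q \<in> J" by simp
  then show False using n by (simp add: J_def)
qed

lemma maximal_ideal_total:
  assumes "maximal_ideal I" "x \<in> A" "y \<in> A"
  shows "x \<boxminus> y \<in> I \<or> y \<boxminus> x \<in> I"
  using assms maximal_ideal_prime prelinear by simp

end

section \<open>Real-valued homomorphisms on bounded chains\<close>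

text \<open>For a superadditive \<phi> the limit of \<phi>(x^n)/n is a supremum (Fekete), which
  serves as the definition of \<sigma>. The defect of at most 1 in \<open>upper\<close> makes n *
  \<sigma>(x) differ from \<phi>(x^n) by at most 1 for every n; additivity follows because an error
  that stays bounded under multiplication by n is zero.\<close>

lemma quasimorphism_homogenization:
  fixes G (structure) and \<phi> :: "'a \<Rightarrow> nat"
  assumes "comm_monoid G"
    and lower: "\<And>x y. \<lbrakk>x \<in> carrier G; y \<in> carrier G\<rbrakk> \<Longrightarrow> \<phi> x + \<phi> y \<le> \<phi> (x \<otimes> y)"
    and upper: "\<And>x y. \<lbrakk>x \<in> carrier G; y \<in> carrier G\<rbrakk> \<Longrightarrow> \<phi> (x \<otimes> y) \<le> \<phi> x + \<phi> y + 1"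
  obtains \<sigma> :: "'a \<Rightarrow> real"
    where "\<And>x n. x \<in> carrier G \<Longrightarrow> real (\<phi> (x [^] (n::nat))) \<le> real n * \<sigma> x"
      and "\<And>x n. x \<in> carrier G \<Longrightarrow> real n * \<sigma> x \<le> real (\<phi> (x [^] (n::nat))) + 1"
      and "\<And>x y. \<lbrakk>x \<in> carrier G; y \<in> carrier G\<rbrakk> \<Longrightarrow> \<sigma> (x \<otimes> y) = \<sigma> x + \<sigma> y"
proof -
  interpret comm_monoid G by fact
  have one: "\<phi> \<one> = 0" using lower[of \<one> \<one>] by simp
  have pow: "n * \<phi> x \<le> \<phi> (x [^] n) \<and> \<phi> (x [^] n) \<le> n * \<phi> x + n" if "x \<in> carrier G" for x and n :: nat
  proof (induction n)
    case 0
    then show ?case by (simp add: one)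
  next
    case (Suc n)
    then show ?case using lower[of "x [^] n" x] upper[of "x [^] n" x] that by simp
  qed
  \<comment> \<open>Both sides are compared with the value of \<phi> at the power with exponent m *
    n.\<close>
  have mn: "m * \<phi> (x [^] n) \<le> n * \<phi> (x [^] m) + n" if "x \<in> carrier G" for x and m n :: nat
    using pow[of "x [^] n" m] pow[of "x [^] m" n] that by (simp add: nat_pow_pow mult.commute)
  define \<sigma> where "\<sigma> x = (SUP n\<in>{1..}. real (\<phi> (x [^] (n::nat))) / real n)" for x
  have bound: "real (\<phi> (x [^] m)) / real m \<le> (real (\<phi> (x [^] n)) + 1) / real n"
    if "x \<in> carrier G" "m \<ge> 1" "n \<ge> 1" for x and m n :: nat
  proof -
    have "real (n * \<phi> (x [^] m)) \<le> real (m * \<phi> (x [^] n) + m)" using mn[of x n m] that by linarith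
    then show ?thesis using that by (simp add: field_simps)
  qed
  have lo: "real (\<phi> (x [^] n)) \<le> real n * \<sigma> x" if x: "x \<in> carrier G" for x and n :: nat
  proof (cases "n = 0")
    case False
    have "real (\<phi> (x [^] n)) / real n \<le> \<sigma> x" unfolding \<sigma>_def
      by (rule cSUP_upper) (use bound[OF x, of _ 1] False in \<open>auto intro!: bdd_aboveI2\<close>)
    then show ?thesis using False by (simp add: field_simps)
  qed (simp add: one)
  have hi: "real n * \<sigma> x \<le> real (\<phi> (x [^] n)) + 1" if x: "x \<in> carrier G" for x and n :: nat
  proof (cases "n = 0")
    case False
    have "\<sigma> x \<le> (real (\<phi> (x [^] n)) + 1) / real n" unfolding \<sigma>_def
      by (rule cSUP_least) (use bound[OF x, of _ n] False in auto)
    then show ?thesis using False by (simp add: field_simps)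
  qed simp
  have "\<sigma> (x \<otimes> y) = \<sigma> x + \<sigma> y" if xy: "x \<in> carrier G" "y \<in> carrier G" for x y
  proof (rule ccontr)
    assume ne: "\<sigma> (x \<otimes> y) \<noteq> \<sigma> x + \<sigma> y"
    define d where "d = \<bar>\<sigma> (x \<otimes> y) - (\<sigma> x + \<sigma> y)\<bar>"
    have "d > 0" using ne by (simp add: d_def)
    \<comment> \<open>The rounding errors of the three values of \<sigma> and the single defect of
      \<phi> never amount to more than 3, whatever \<open>n\<close> is.\<close>
    then obtain n :: nat where n: "real n * d > 3" using reals_Archimedean3 by blast
    have e: "(x \<otimes> y) [^] n = x [^] n \<otimes> y [^] n" using xy by (simp add: nat_pow_distrib)
    have "real (\<phi> (x [^] n)) + real (\<phi> (y [^] n)) \<le> real (\<phi> ((x \<otimes> y) [^] n))"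
      using lower[of "x [^] n" "y [^] n"] xy e by simp
    moreover have "real (\<phi> ((x \<otimes> y) [^] n)) \<le> real (\<phi> (x [^] n)) + real (\<phi> (y [^] n)) + 1"
      using upper[of "x [^] n" "y [^] n"] xy e by simp
    ultimately have "\<bar>real n * \<sigma> (x \<otimes> y) - (real n * \<sigma> x + real n * \<sigma> y)\<bar> \<le> 3"
      using lo[OF xy(1), of n] lo[OF xy(2), of n] hi[OF xy(1), of n] hi[OF xy(2), of n]
        lo[of "x \<otimes> y" n] hi[of "x \<otimes> y" n] xy by simp
    moreover have "real n * \<sigma> (x \<otimes> y) - (real n * \<sigma> x + real n * \<sigma> y)
        = real n * (\<sigma> (x \<otimes> y) - (\<sigma> x + \<sigma> y))" by (simp add: algebra_simps)
    ultimately show False using n by (simp add: d_def abs_mult)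
  qed
  then show ?thesis using that lo hi by blast
qed

locale bounded_hoop_chain = dual_wajsberg_hoop +
  fixes u :: 'a
  assumes top_closed [simp, intro]: "u \<in> A"
    and top_ne_zero: "u \<noteq> \<bottom>"
    and le_top [simp]: "x \<in> A \<Longrightarrow> x \<sqsubseteq> u"
    and total: "\<lbrakk>x \<in> A; y \<in> A\<rbrakk> \<Longrightarrow> x \<sqsubseteq> y \<or> y \<sqsubseteq> x"
begin

text \<open>The Lukasiewicz product, max (x + y - 1) 0 on the unit interval: the remainder of a sum
  after a carry of the unit \<open>u\<close>.\<close>

definition conj :: "'a \<Rightarrow> 'a \<Rightarrow> 'a" (infixl \<open>\<odot>\<close> 70)
  where "x \<odot> y = x \<boxminus> (u \<boxminus> y)"

section \<open>Complement, product and carries on a chain\<close>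

lemma top_le: "x \<in> A \<Longrightarrow> u \<sqsubseteq> x \<longleftrightarrow> x = u"
  by (metis le_antisym le_top top_closed)

lemma neg_neg [simp]: "x \<in> A \<Longrightarrow> u \<boxminus> (u \<boxminus> x) = x"
  by (simp add: minus_minus_self)

lemma conj_closed [simp, intro]: "\<lbrakk>x \<in> A; y \<in> A\<rbrakk> \<Longrightarrow> x \<odot> y \<in> A"
  by (simp add: conj_def)

lemma conj_de_morgan: "\<lbrakk>x \<in> A; y \<in> A\<rbrakk> \<Longrightarrow> x \<odot> y = u \<boxminus> ((u \<boxminus> x) \<boxplus> (u \<boxminus> y))"
  by (simp add: conj_def minus_plus)

lemma conj_comm: "\<lbrakk>x \<in> A; y \<in> A\<rbrakk> \<Longrightarrow> x \<odot> y = y \<odot> x"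
  by (metis conj_de_morgan minus_closed plus_comm top_closed)

lemma conj_assoc: "\<lbrakk>x \<in> A; y \<in> A; z \<in> A\<rbrakk> \<Longrightarrow> (x \<odot> y) \<odot> z = x \<odot> (y \<odot> z)"
  by (simp add: conj_de_morgan plus_assoc)

lemma conj_eq_topD: "\<lbrakk>x \<odot> y = u; x \<in> A; y \<in> A\<rbrakk> \<Longrightarrow> x = u"
  by (metis conj_def minus_closed minus_le top_closed top_le)

lemma conj_ne_top: "\<lbrakk>x \<noteq> u; x \<in> A; y \<in> A\<rbrakk> \<Longrightarrow> x \<odot> y \<noteq> u"
  using conj_eq_topD[of x y] by blast

lemma plus_eq_top: "\<lbrakk>x \<in> A; y \<in> A\<rbrakk> \<Longrightarrow> x \<boxplus> y = u \<longleftrightarrow> u \<boxminus> y \<sqsubseteq> x"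
  using top_le[of "x \<boxplus> y"] residuation[of u y x] plus_comm[of x y] by simp

text \<open>Totality turns a sum that misses \<open>u\<close> into one that is not truncated: each
  summand lies below the complement of the other, where \<open>plus_minus_cancel\<close>
  applies.\<close>

lemma plus_ne_top: "\<lbrakk>x \<boxplus> y \<noteq> u; x \<in> A; y \<in> A\<rbrakk> \<Longrightarrow> x \<sqsubseteq> u \<boxminus> y"
  using plus_eq_top[of x y] total[of x "u \<boxminus> y"] by simp

lemma plus_top [simp]: "x \<in> A \<Longrightarrow> x \<boxplus> u = u" "x \<in> A \<Longrightarrow> u \<boxplus> x = u"
  by (simp_all add: plus_eq_top)

text \<open>The sum is the complement of \<open>(u \<boxminus> t) \<boxminus> s\<close>. Subtracting
  \<open>s\<close> from this complement adds \<open>s\<close> back inside it, which restores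
  \<open>u \<boxminus> t\<close> because \<open>s\<close> lies below that.\<close>

lemma plus_minus_cancel:
  assumes "t \<sqsubseteq> u \<boxminus> s" and [simp]: "t \<in> A" "s \<in> A"
  shows "(t \<boxplus> s) \<boxminus> s = t"
proof -
  have s: "s \<sqsubseteq> u \<boxminus> t"
    using assms minus_antimono[of t "u \<boxminus> s" u] by simp
  have "t \<boxplus> s = u \<boxminus> ((u \<boxminus> t) \<boxminus> s)"
    using minus_plus[of u t s] neg_neg[of "t \<boxplus> s"] by simp
  then have "(t \<boxplus> s) \<boxminus> s = u \<boxminus> (((u \<boxminus> t) \<boxminus> s) \<boxplus> s)" by (simp add: minus_plus)
  then show ?thesis using s by (simp add: minus_add)
qed

text \<open>This and the next three lemmas are the cases of associativity with carry, named after
  which of the inner sums \<open>a \<boxplus> b\<close> and \<open>b \<boxplus> c\<close> reach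
  \<open>u\<close>. With \<open>p\<close> the complement of \<open>b\<close>, both sides here amount
  to a + c - p; reflecting in \<open>[\<bottom>, p]\<close> makes the expression symmetric in
  \<open>a\<close> and \<open>c\<close>.\<close>

lemma carry_neither:
  assumes "a \<boxplus> b \<noteq> u" "b \<boxplus> c \<noteq> u" and [simp]: "a \<in> A" "b \<in> A" "c \<in> A"
  shows "(a \<boxplus> b) \<odot> c = a \<odot> (b \<boxplus> c)"
proof -
  define p where "p = u \<boxminus> b"
  have [simp]: "p \<in> A" by (simp add: p_def)
  have "a \<sqsubseteq> p" "c \<sqsubseteq> p"
    using assms plus_ne_top[of a b] plus_ne_top[of c b] by (simp_all add: p_def plus_comm)
  have "(a \<boxplus> b) \<odot> c = c \<boxminus> (p \<boxminus> a)"
    using conj_comm[of "a \<boxplus> b" c] by (simp add: conj_def p_def plus_comm[of a b] minus_plus)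
  also have "\<dots> = (p \<boxminus> (p \<boxminus> c)) \<boxminus> (p \<boxminus> a)" using \<open>c \<sqsubseteq> p\<close> by (simp add: minus_minus_self)
  also have "\<dots> = (p \<boxminus> (p \<boxminus> a)) \<boxminus> (p \<boxminus> c)" by (simp add: minus_minus_comm)
  also have "\<dots> = a \<boxminus> (p \<boxminus> c)" using \<open>a \<sqsubseteq> p\<close> by (simp add: minus_minus_self)
  also have "\<dots> = a \<odot> (b \<boxplus> c)" by (simp add: conj_def p_def minus_plus)
  finally show ?thesis .
qed

text \<open>The complement of \<open>a \<boxplus> b\<close> is \<open>s = p \<boxminus> a\<close>,
  and \<open>c\<close> splits as \<open>t \<boxplus> s\<close> with \<open>t\<close> the desired
  right-hand side. As \<open>c\<close> is not \<open>u\<close>, this sum is not truncated and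
  \<open>s\<close> cancels.\<close>

lemma carry_right:
  assumes "a \<boxplus> b \<noteq> u" "b \<boxplus> c = u" "c \<noteq> u" and [simp]: "a \<in> A" "b \<in> A" "c \<in> A"
  shows "(a \<boxplus> b) \<odot> c = a \<boxplus> (b \<odot> c)"
proof -
  define p where "p = u \<boxminus> b"
  have [simp]: "p \<in> A" by (simp add: p_def)
  have ap: "a \<sqsubseteq> p" and pc: "p \<sqsubseteq> c"
    using assms plus_ne_top[of a b] plus_eq_top[of c b] by (simp_all add: p_def plus_comm)
  define s where "s = p \<boxminus> a"
  define t where "t = a \<boxplus> (c \<boxminus> p)"
  have [simp]: "s \<in> A" "t \<in> A" by (simp_all add: s_def t_def)
  have "p = a \<boxplus> s" using ap by (simp add: s_def add_minus)
  moreover have "c = p \<boxplus> (c \<boxminus> p)" using pc by (simp add: add_minus)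
  ultimately have "c = (a \<boxplus> s) \<boxplus> (c \<boxminus> p)" by simp
  then have c: "c = t \<boxplus> s" using plus_comm[of s "c \<boxminus> p"] by (simp add: t_def plus_assoc)
  have "(a \<boxplus> b) \<odot> c = c \<boxminus> s"
    using conj_comm[of "a \<boxplus> b" c] by (simp add: conj_def p_def s_def plus_comm[of a b] minus_plus)
  also have "\<dots> = t" using c plus_minus_cancel[of t s] plus_ne_top[of t s] assms(3) by simp
  also have "\<dots> = a \<boxplus> (b \<odot> c)" using conj_comm[of b c] by (simp add: t_def conj_def p_def)
  finally show ?thesis .
qed

lemma carry_left:
  assumes "a \<boxplus> b = u" "b \<boxplus> c \<noteq> u" "a \<noteq> u" and [simp]: "a \<in> A" "b \<in> A" "c \<in> A"
  shows "(a \<odot> b) \<boxplus> c = a \<odot> (b \<boxplus> c)"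
  using carry_right[of c b a] assms by (simp add: plus_comm conj_comm)

text \<open>Both \<open>a\<close> and \<open>c\<close> exceed the complement \<open>p\<close> of
  \<open>b\<close>, so the one copy of \<open>p\<close> that is taken away may come from either of
  them.\<close>

lemma carry_both:
  assumes "a \<boxplus> b = u" "b \<boxplus> c = u" and [simp]: "a \<in> A" "b \<in> A" "c \<in> A"
  shows "(a \<odot> b) \<boxplus> c = a \<boxplus> (b \<odot> c)"
proof -
  define p where "p = u \<boxminus> b"
  have [simp]: "p \<in> A" by (simp add: p_def)
  have pa: "p \<sqsubseteq> a" and pc: "p \<sqsubseteq> c"
    using assms plus_eq_top[of a b] plus_eq_top[of c b] by (simp_all add: p_def plus_comm)
  have "(a \<boxminus> p) \<boxplus> c = (a \<boxminus> p) \<boxplus> (p \<boxplus> (c \<boxminus> p))" using pc by (simp add: add_minus)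
  also have "\<dots> = ((a \<boxminus> p) \<boxplus> p) \<boxplus> (c \<boxminus> p)" by (simp add: plus_assoc)
  also have "\<dots> = a \<boxplus> (c \<boxminus> p)" using pa by (simp add: minus_add)
  finally show ?thesis using conj_comm[of b c] by (simp add: conj_def p_def)
qed

text \<open>The positive cone of Chang's totally ordered group: \<open>(k, a)\<close> stands for \<open>k\<close> units plus \<open>a\<close>,
  with a carry as soon as the fractional parts reach the unit \<open>u\<close>.\<close>

definition chang_monoid :: "(nat \<times> 'a) monoid"
  where "chang_monoid = \<lparr>carrier = UNIV \<times> {a \<in> A. a \<noteq> u},
    mult = (\<lambda>(k, a) (l, b). if a \<boxplus> b = u then (k + l + 1, a \<odot> b) else (k + l, a \<boxplus> b)),
    one = (0, \<bottom>)\<rparr>"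

lemma chang_monoid_carrier [simp]: "(k, a) \<in> carrier chang_monoid \<longleftrightarrow> a \<in> A \<and> a \<noteq> u"
  by (simp add: chang_monoid_def)

lemma chang_monoid_mult [simp]: "(k, a) \<otimes>\<^bsub>chang_monoid\<^esub> (l, b) =
    (if a \<boxplus> b = u then (k + l + 1, a \<odot> b) else (k + l, a \<boxplus> b))"
  by (simp add: chang_monoid_def)

lemma chang_monoid_one [simp]: "\<one>\<^bsub>chang_monoid\<^esub> = (0, \<bottom>)"
  by (simp add: chang_monoid_def)

lemma chang_monoid_assoc:
  assumes [simp]: "a \<in> A" "b \<in> A" "c \<in> A" and ne: "a \<noteq> u" "b \<noteq> u" "c \<noteq> u"
  shows "((k, a) \<otimes>\<^bsub>chang_monoid\<^esub> (l, b)) \<otimes>\<^bsub>chang_monoid\<^esub> (m, c) =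
    (k, a) \<otimes>\<^bsub>chang_monoid\<^esub> ((l, b) \<otimes>\<^bsub>chang_monoid\<^esub> (m, c))"
proof -
  have sum: "(a \<boxplus> b) \<boxplus> c = a \<boxplus> (b \<boxplus> c)" by (simp add: plus_assoc)
  consider (neither) "a \<boxplus> b \<noteq> u" "b \<boxplus> c \<noteq> u" | (right) "a \<boxplus> b \<noteq> u" "b \<boxplus> c = u"
    | (left) "a \<boxplus> b = u" "b \<boxplus> c \<noteq> u" | (both) "a \<boxplus> b = u" "b \<boxplus> c = u" by blast
  then show ?thesis
  proof cases
    case neither
    then show ?thesis using sum carry_neither[of a b c] by simp
  next
    case right
    \<comment> \<open>The inner sum has already carried, so the outer one must not carry again;
      otherwise the integer parts would differ.\<close>
    then have "a \<boxplus> (b \<odot> c) \<noteq> u"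
      using carry_right[of a b c] conj_eq_topD[of "a \<boxplus> b" c] ne by auto
    then show ?thesis using right sum carry_right[of a b c] ne by simp
  next
    case left
    then have "(a \<odot> b) \<boxplus> c \<noteq> u"
      using carry_left[of a b c] conj_eq_topD[of a "b \<boxplus> c"] ne by auto
    then show ?thesis using left sum carry_left[of a b c] ne
      by (simp add: plus_assoc[symmetric])
  next
    case both
    then show ?thesis using carry_both[of a b c] by (simp add: conj_assoc)
  qed
qed

lemma comm_monoid_chang_monoid: "comm_monoid chang_monoid"
proof (rule comm_monoidI)
  fix x y z
  assume "x \<in> carrier chang_monoid" "y \<in> carrier chang_monoid" "z \<in> carrier chang_monoid"
  then show "x \<otimes>\<^bsub>chang_monoid\<^esub> y \<otimes>\<^bsub>chang_monoid\<^esub> z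
      = x \<otimes>\<^bsub>chang_monoid\<^esub> (y \<otimes>\<^bsub>chang_monoid\<^esub> z)"
    by (cases x; cases y; cases z) (simp del: chang_monoid_mult add: chang_monoid_assoc)
next
  fix x y assume "x \<in> carrier chang_monoid" "y \<in> carrier chang_monoid"
  then show "x \<otimes>\<^bsub>chang_monoid\<^esub> y \<in> carrier chang_monoid"
    by (cases x; cases y) (simp add: conj_ne_top)
next
  fix x y assume "x \<in> carrier chang_monoid" "y \<in> carrier chang_monoid"
  then show "x \<otimes>\<^bsub>chang_monoid\<^esub> y = y \<otimes>\<^bsub>chang_monoid\<^esub> x"
    by (cases x; cases y) (simp add: plus_comm conj_comm)
next
  fix x assume "x \<in> carrier chang_monoid"
  then show "\<one>\<^bsub>chang_monoid\<^esub> \<otimes>\<^bsub>chang_monoid\<^esub> x = x"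
    by (cases x) simp
qed (use top_ne_zero in simp)

text \<open>One addition produces at most one carry, so the integer part \<open>fst\<close>
  satisfies the hypotheses of \<open>quasimorphism_homogenization\<close>. The resulting additive
  map, restricted to fractional parts, gives \<open>s\<close>; the truncation at 1 reflects the
  carry.\<close>

theorem state_exists:
  obtains s :: "'a \<Rightarrow> real"
    where "\<And>x. x \<in> A \<Longrightarrow> 0 \<le> s x" "\<And>x. x \<in> A \<Longrightarrow> s x \<le> 1" "s u = 1"
      "\<And>x y. \<lbrakk>x \<in> A; y \<in> A\<rbrakk> \<Longrightarrow> s (x \<boxplus> y) = min (s x + s y) 1"
      "\<And>x y. \<lbrakk>x \<in> A; y \<in> A\<rbrakk> \<Longrightarrow> s (x \<boxminus> y) = max (s x - s y) 0"
proof -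
  interpret C: comm_monoid chang_monoid by (rule comm_monoid_chang_monoid)
  have *: "fst x + fst y \<le> fst (x \<otimes>\<^bsub>chang_monoid\<^esub> y)"
    "fst (x \<otimes>\<^bsub>chang_monoid\<^esub> y) \<le> fst x + fst y + 1" for x y
    by (cases x; cases y; simp)+
  obtain \<sigma> :: "nat \<times> 'a \<Rightarrow> real"
    where lo: "\<And>x n. x \<in> carrier chang_monoid \<Longrightarrow>
        real (fst (x [^]\<^bsub>chang_monoid\<^esub> (n::nat))) \<le> real n * \<sigma> x"
      and hi: "\<And>x n. x \<in> carrier chang_monoid \<Longrightarrow>
        real n * \<sigma> x \<le> real (fst (x [^]\<^bsub>chang_monoid\<^esub> (n::nat))) + 1"
      and add: "\<And>x y. \<lbrakk>x \<in> carrier chang_monoid; y \<in> carrier chang_monoid\<rbrakk> \<Longrightarrow>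
        \<sigma> (x \<otimes>\<^bsub>chang_monoid\<^esub> y) = \<sigma> x + \<sigma> y"
    using quasimorphism_homogenization[of chang_monoid fst] comm_monoid_chang_monoid *
    by blast
  have \<sigma>0: "\<sigma> (0, \<bottom>) = 0"
    using add[of "(0, \<bottom>)" "(0, \<bottom>)"] top_ne_zero by simp
  have pow1: "(1, \<bottom>) [^]\<^bsub>chang_monoid\<^esub> (n::nat) = (n, \<bottom>)" for n
    by (induction n) (use top_ne_zero in auto)
  \<comment> \<open>The n-th multiple of the unit has integer part exactly n, so an excess over 1
    would break the bound \<open>hi\<close> for large n.\<close>
  have \<sigma>1: "\<sigma> (1, \<bottom>) = 1"
  proof (rule ccontr)
    assume ne: "\<sigma> (1, \<bottom>) \<noteq> 1"
    have ge: "\<sigma> (1, \<bottom>) \<ge> 1" using lo[of "(1, \<bottom>)" 1] top_ne_zero by simp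
    then obtain n :: nat where "real n * (\<sigma> (1, \<bottom>) - 1) > 1"
      using ne reals_Archimedean3[of "\<sigma> (1, \<bottom>) - 1"] by auto
    then show False using hi[of "(1, \<bottom>)" n] top_ne_zero by (simp only: pow1) (simp add: algebra_simps)
  qed
  have carry: "\<sigma> (0, x) + \<sigma> (0, y) = 1 + \<sigma> (0, x \<odot> y)"
    if "x \<in> A" "y \<in> A" "x \<noteq> u" "y \<noteq> u" "x \<boxplus> y = u" for x y
  proof -
    have c: "x \<odot> y \<noteq> u" using that by (simp add: conj_ne_top)
    have "\<sigma> (0, x) + \<sigma> (0, y) = \<sigma> (1, x \<odot> y)" using that add[of "(0, x)" "(0, y)"] by simp
    also have "\<dots> = 1 + \<sigma> (0, x \<odot> y)"
      using add[of "(1, \<bottom>)" "(0, x \<odot> y)"] c that \<sigma>1 top_ne_zero by simp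
    finally show ?thesis .
  qed
  have nonneg: "\<sigma> (0, x) \<ge> 0" if "x \<in> A" "x \<noteq> u" for x
    using lo[of "(0, x)" 1] that by simp
  \<comment> \<open>The top \<open>u\<close> is not a fractional part: in Chang's monoid it is
    represented by \<open>(1, \<bottom>)\<close>, whose value is 1.\<close>
  define s where "s x = (if x = u then 1 else \<sigma> (0, x))" for x
  have s_bot: "s \<bottom> = 0" using \<sigma>0 top_ne_zero by (auto simp: s_def)
  have s_top: "s u = 1" by (simp add: s_def)
  have s_nonneg: "0 \<le> s x" if "x \<in> A" for x using nonneg that by (auto simp: s_def)
  have s_neg: "s (u \<boxminus> x) = 1 - s x" if x: "x \<in> A" for x
  proof (cases "x = \<bottom> \<or> x = u")
    case True
    then show ?thesis using s_bot by (auto simp: s_def)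
  next
    case False
    have "u \<boxminus> x \<noteq> u" using neg_neg[OF x] False by auto
    moreover have "x \<odot> (u \<boxminus> x) = \<bottom>" using x by (simp add: conj_def)
    ultimately show ?thesis
      using False carry[of x "u \<boxminus> x"] x \<sigma>0 add_minus[of x u] by (simp add: s_def)
  qed
  have s_le: "s x \<le> 1" if "x \<in> A" for x
    using s_neg[OF that] s_nonneg[of "u \<boxminus> x"] that by simp
  have s_plus: "s (x \<boxplus> y) = s x + s y" if "x \<in> A" "y \<in> A" "x \<boxplus> y \<noteq> u" for x y
  proof -
    have "x \<noteq> u" "y \<noteq> u" using that by auto
    then show ?thesis using that add[of "(0, x)" "(0, y)"] by (simp add: s_def)
  qed
  have s_plus_top: "s x + s y \<ge> 1" if "x \<in> A" "y \<in> A" "x \<boxplus> y = u" for x y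
  proof (cases "x = u \<or> y = u")
    case True
    then show ?thesis using s_nonneg[OF that(1)] s_nonneg[OF that(2)] s_top
      by (elim disjE) simp_all
  next
    case False
    then show ?thesis
      using carry[of x y] that nonneg[of "x \<odot> y"] conj_ne_top[of x y] by (simp add: s_def)
  qed
  have s_add: "s (x \<boxplus> y) = min (s x + s y) 1" if "x \<in> A" "y \<in> A" for x y
    using s_plus[OF that] s_plus_top[OF that] s_le[of "x \<boxplus> y"] s_top that
    by (cases "x \<boxplus> y = u") simp_all
  have s_mono: "s x \<le> s y" if "x \<sqsubseteq> y" "x \<in> A" "y \<in> A" for x y
    using s_add[of x "y \<boxminus> x"] add_minus[OF that] that s_nonneg[of "y \<boxminus> x"] s_le[of x] by simp
  have s_minus: "s (x \<boxminus> y) = max (s x - s y) 0" if xy: "x \<in> A" "y \<in> A" for x y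
  proof -
    \<comment> \<open>\<open>s_plus\<close> can be applied to
      \<open>(x \<boxminus> y) \<boxplus> y = x\<close> only if this sum does not reach
      \<open>u\<close>; for \<open>x = u\<close> the difference is a complement.\<close>
    consider "x \<sqsubseteq> y" | "y \<sqsubseteq> x" "x = u" | "y \<sqsubseteq> x" "x \<noteq> u" using total[OF xy] by blast
    then show ?thesis
    proof cases
      case 1
      then show ?thesis using xy s_mono[of x y] s_bot by (simp add: le_def)
    next
      case 2
      then show ?thesis using xy s_neg[of y] s_le[of y] s_top by simp
    next
      case 3
      then show ?thesis
        using xy s_plus[of "x \<boxminus> y" y] minus_add[of y x] s_nonneg[of "x \<boxminus> y"] by simp
    qed
  qed
  show ?thesis by (rule that) (fact s_nonneg s_le s_top s_add s_minus)+
qed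

end

section \<open>Quotients by maximal ideals\<close>

context dual_wajsberg_hoop
begin

text \<open>A triangle inequality for the one-sided distance \<open>\<boxminus>\<close>. It yields
  transitivity of the congruence and its compatibility with differences.\<close>

lemma minus_triangle:
  assumes [simp]: "x \<in> A" "y \<in> A" "z \<in> A"
  shows "x \<boxminus> z \<sqsubseteq> (x \<boxminus> y) \<boxplus> (y \<boxminus> z)"
proof -
  have "x \<sqsubseteq> y \<boxplus> (x \<boxminus> y)" by (simp add: le_minus_add)
  also have "y \<boxplus> (x \<boxminus> y) \<sqsubseteq> (z \<boxplus> (y \<boxminus> z)) \<boxplus> (x \<boxminus> y)"
    by (rule plus_mono) (simp_all add: le_minus_add)
  also have "(z \<boxplus> (y \<boxminus> z)) \<boxplus> (x \<boxminus> y) = z \<boxplus> ((x \<boxminus> y) \<boxplus> (y \<boxminus> z))"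
    using plus_comm[of "y \<boxminus> z" "x \<boxminus> y"] by (simp add: plus_assoc)
  finally show ?thesis by (simp add: residuation)
qed

section \<open>Congruence modulo an ideal and its quotient\<close>

definition cong :: "'a set \<Rightarrow> 'a \<Rightarrow> 'a \<Rightarrow> bool"
  where "cong I x y \<longleftrightarrow> x \<boxminus> y \<in> I \<and> y \<boxminus> x \<in> I"

text \<open>Chosen representatives instead of cosets keep the quotient inside \<open>A\<close>, with
  the same element type; its operations are those of \<open>A\<close> followed by
  \<open>rep\<close>.\<close>

definition rep :: "'a set \<Rightarrow> 'a \<Rightarrow> 'a"
  where "rep I x = (SOME y. y \<in> A \<and> cong I x y)"

context
  fixes I
  assumes I: "ideal I"
begin

lemma cong_refl: "x \<in> A \<Longrightarrow> cong I x x"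
  using I by (simp add: cong_def ideal_zero)

lemma cong_sym: "cong I x y \<Longrightarrow> cong I y x"
  by (simp add: cong_def)

lemma cong_trans:
  assumes "cong I x y" "cong I y z" and [simp]: "x \<in> A" "y \<in> A" "z \<in> A"
  shows "cong I x z"
  using assms(1,2) ideal_down[OF I ideal_plus[OF I] minus_triangle[of x y z]]
    ideal_down[OF I ideal_plus[OF I] minus_triangle[of z y x]]
  by (simp add: cong_def)

text \<open>In this and the next two lemmas the operation does not increase the one-sided distance
  of its arguments, so membership in \<open>I\<close> is inherited downwards.\<close>

lemma cong_plus:
  assumes xy: "cong I x y" and [simp]: "x \<in> A" "y \<in> A" "z \<in> A"
  shows "cong I (x \<boxplus> z) (y \<boxplus> z)"
proof -
  have *: "(p \<boxplus> z) \<boxminus> (q \<boxplus> z) \<sqsubseteq> p \<boxminus> q" if [simp]: "p \<in> A" "q \<in> A" for p q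
  proof -
    have "p \<boxplus> z \<sqsubseteq> (q \<boxplus> (p \<boxminus> q)) \<boxplus> z" by (rule plus_mono) (simp_all add: le_minus_add)
    also have "\<dots> = (q \<boxplus> z) \<boxplus> (p \<boxminus> q)"
      using plus_comm[of "p \<boxminus> q" z] by (simp add: plus_assoc)
    finally show ?thesis by (simp add: residuation)
  qed
  show ?thesis using xy ideal_down[OF I _ *[of x y]] ideal_down[OF I _ *[of y x]]
    by (simp add: cong_def)
qed

lemma cong_minus_left:
  assumes xy: "cong I x y" and [simp]: "x \<in> A" "y \<in> A" "z \<in> A"
  shows "cong I (x \<boxminus> z) (y \<boxminus> z)"
proof -
  have *: "(p \<boxminus> z) \<boxminus> (q \<boxminus> z) \<sqsubseteq> p \<boxminus> q" if [simp]: "p \<in> A" "q \<in> A" for p q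
    using minus_triangle[of p q z] plus_comm[of "p \<boxminus> q" "q \<boxminus> z"] by (simp add: residuation)
  show ?thesis using xy ideal_down[OF I _ *[of x y]] ideal_down[OF I _ *[of y x]]
    by (simp add: cong_def)
qed

lemma cong_minus_right:
  assumes xy: "cong I x y" and [simp]: "x \<in> A" "y \<in> A" "z \<in> A"
  shows "cong I (z \<boxminus> x) (z \<boxminus> y)"
proof -
  have *: "(z \<boxminus> p) \<boxminus> (z \<boxminus> q) \<sqsubseteq> q \<boxminus> p" if [simp]: "p \<in> A" "q \<in> A" for p q
    using minus_triangle[of z q p] by (simp add: residuation)
  show ?thesis using xy ideal_down[OF I _ *[of x y]] ideal_down[OF I _ *[of y x]]
    by (simp add: cong_def)
qed

lemma rep: 
  assumes "x \<in> A"
  shows rep_closed: "rep I x \<in> A" and cong_rep: "cong I x (rep I x)"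
  unfolding rep_def using someI[of "\<lambda>y. y \<in> A \<and> cong I x y" x] assms cong_refl by auto

lemma rep_eq_iff:
  assumes "x \<in> A" "y \<in> A"
  shows "rep I x = rep I y \<longleftrightarrow> cong I x y"
proof
  assume "rep I x = rep I y"
  then show "cong I x y"
    using assms cong_rep cong_trans[of x "rep I x" y] cong_sym rep_closed by metis
next
  assume "cong I x y"
  then have "(\<lambda>z. z \<in> A \<and> cong I x z) = (\<lambda>z. z \<in> A \<and> cong I y z)"
    using assms cong_trans[of x y] cong_trans[of y x] cong_sym by blast
  then show "rep I x = rep I y" by (simp add: rep_def)
qed

lemma rep_rep: "x \<in> A \<Longrightarrow> rep I (rep I x) = rep I x"
  by (simp add: rep_eq_iff rep_closed cong_rep cong_sym)

lemma rep_plus: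
  assumes "x \<in> A" "y \<in> A"
  shows "rep I (rep I x \<boxplus> y) = rep I (x \<boxplus> y)" "rep I (x \<boxplus> rep I y) = rep I (x \<boxplus> y)"
proof -
  have *: "rep I (rep I p \<boxplus> q) = rep I (p \<boxplus> q)" if "p \<in> A" "q \<in> A" for p q
    using that by (simp add: rep_eq_iff rep_closed cong_plus cong_rep cong_sym)
  show "rep I (rep I x \<boxplus> y) = rep I (x \<boxplus> y)" by (simp add: * assms)
  show "rep I (x \<boxplus> rep I y) = rep I (x \<boxplus> y)"
    using *[of y x] assms rep_closed[of y] by (simp add: plus_comm)
qed

lemma rep_minus:
  assumes "x \<in> A" "y \<in> A"
  shows "rep I (rep I x \<boxminus> y) = rep I (x \<boxminus> y)" "rep I (x \<boxminus> rep I y) = rep I (x \<boxminus> y)"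
  using assms
  by (simp_all add: rep_eq_iff rep_closed cong_minus_left cong_minus_right cong_rep cong_sym)

lemma rep_eq_zero_iff: "x \<in> A \<Longrightarrow> rep I x = rep I \<bottom> \<longleftrightarrow> x \<in> I"
  using I by (simp add: rep_eq_iff cong_def ideal_zero)

text \<open>An outer \<open>rep\<close> absorbs the inner ones, so each equation reduces to its
  instance at preimages.\<close>

lemma quotient_hoop:
  "dual_wajsberg_hoop (rep I ` A) (\<lambda>x y. rep I (x \<boxplus> y)) (\<lambda>x y. rep I (x \<boxminus> y)) (rep I \<bottom>)"
proof unfold_locales
  fix x y assume "x \<in> rep I ` A" "y \<in> rep I ` A"
  then obtain p q where [simp]: "p \<in> A" "q \<in> A" "x = rep I p" "y = rep I q" by blast
  show "rep I (x \<boxplus> y) = rep I (y \<boxplus> x)"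
    using plus_comm[of p q] by (simp add: rep_plus rep_closed)
  show "rep I (rep I (x \<boxminus> y) \<boxplus> y) = rep I (rep I (y \<boxminus> x) \<boxplus> x)"
    using sup_comm[of p q] by (simp add: rep_plus rep_minus rep_closed)
  show "rep I (x \<boxminus> rep I (x \<boxminus> y)) = rep I (y \<boxminus> rep I (y \<boxminus> x))"
    using inf_comm[of p q] by (simp add: rep_minus rep_closed)
next
  fix x y z assume "x \<in> rep I ` A" "y \<in> rep I ` A" "z \<in> rep I ` A"
  then obtain p q r where [simp]: "p \<in> A" "q \<in> A" "r \<in> A"
    "x = rep I p" "y = rep I q" "z = rep I r" by blast
  show "rep I (rep I (x \<boxplus> y) \<boxplus> z) = rep I (x \<boxplus> rep I (y \<boxplus> z))"
    by (simp add: rep_plus rep_closed plus_assoc)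
  show "rep I (x \<boxminus> rep I (y \<boxplus> z)) = rep I (rep I (x \<boxminus> y) \<boxminus> z)"
    by (simp add: rep_plus rep_minus rep_closed minus_plus[of p q r])
qed (auto simp: rep_plus rep_minus rep_closed rep_rep)

end

theorem maximal_ideal_state:
  assumes I: "maximal_ideal I" and a: "a \<in> A" "a \<notin> I" "a \<boxplus> a = a"
  obtains s :: "'a \<Rightarrow> real"
    where "\<And>x. x \<in> A \<Longrightarrow> 0 \<le> s x" "\<And>x. x \<in> A \<Longrightarrow> s x \<le> 1"
      "\<And>x y. \<lbrakk>x \<in> A; y \<in> A\<rbrakk> \<Longrightarrow> s (x \<boxplus> y) = min (s x + s y) 1"
      "\<And>x y. \<lbrakk>x \<in> A; y \<in> A\<rbrakk> \<Longrightarrow> s (x \<boxminus> y) = max (s x - s y) 0"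
      "\<And>x. x \<in> A \<Longrightarrow> s x = 0 \<longleftrightarrow> x \<in> I"
proof -
  have iI: "ideal I" using I by (rule maximal_ideal_ideal)
  note r = rep_closed[OF iI] rep_rep[OF iI] rep_plus[OF iI] rep_minus[OF iI]
    rep_eq_zero_iff[OF iI]
  \<comment> \<open>Idempotency of \<open>a\<close> gives
    \<open>(x \<boxminus> a) \<boxminus> a = x \<boxminus> a\<close>, so
    \<open>x \<boxminus> a\<close> and \<open>a\<close> have meet \<open>\<bottom>\<close>. As
    \<open>a\<close> is outside the prime ideal \<open>I\<close>, the other one is inside; thus
    \<open>a\<close> becomes the top of the quotient.\<close>
  have top: "x \<boxminus> a \<in> I" if x: "x \<in> A" for x
  proof -
    have "(x \<boxminus> a) \<boxminus> a = x \<boxminus> a" by (subst minus_plus[symmetric]) (use x a in simp_all)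
    then show ?thesis using maximal_ideal_prime[OF I, of "x \<boxminus> a" a] a x by simp
  qed
  have le_rep: "rep I (rep I x \<boxminus> rep I y) = rep I \<bottom> \<longleftrightarrow> x \<boxminus> y \<in> I"
    if "x \<in> A" "y \<in> A" for x y using that by (simp add: r)
  interpret Q: dual_wajsberg_hoop "rep I ` A" "\<lambda>x y. rep I (x \<boxplus> y)" "\<lambda>x y. rep I (x \<boxminus> y)"
    "rep I \<bottom>" by (rule quotient_hoop[OF iI])
  interpret Q: bounded_hoop_chain "rep I ` A" "\<lambda>x y. rep I (x \<boxplus> y)" "\<lambda>x y. rep I (x \<boxminus> y)"
    "rep I \<bottom>" "rep I a"
  proof unfold_locales
    show "rep I a \<in> rep I ` A" using a(1) by (rule imageI)
    show "rep I a \<noteq> rep I \<bottom>" using a(1,2) r by simp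
  next
    fix x assume "x \<in> rep I ` A"
    then obtain p where "p \<in> A" "x = rep I p" by blast
    then show "Q.le x (rep I a)" using le_rep[OF _ a(1)] top unfolding Q.le_def by blast
  next
    fix x y assume "x \<in> rep I ` A" "y \<in> rep I ` A"
    then obtain p q where "p \<in> A" "x = rep I p" "q \<in> A" "y = rep I q" by blast
    then show "Q.le x y \<or> Q.le y x"
      using maximal_ideal_total[OF I, of p q] le_rep[of p q] le_rep[of q p] unfolding Q.le_def
      by blast
  qed
  obtain s :: "'a \<Rightarrow> real"
    where s: "\<And>x. x \<in> rep I ` A \<Longrightarrow> 0 \<le> s x" "\<And>x. x \<in> rep I ` A \<Longrightarrow> s x \<le> 1" "s (rep I a) = 1"
      and s_plus: "\<And>x y. \<lbrakk>x \<in> rep I ` A; y \<in> rep I ` A\<rbrakk> \<Longrightarrow> s (rep I (x \<boxplus> y)) = min (s x + s y) 1"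
      and s_minus: "\<And>x y. \<lbrakk>x \<in> rep I ` A; y \<in> rep I ` A\<rbrakk> \<Longrightarrow> s (rep I (x \<boxminus> y)) = max (s x - s y) 0"
    using that by (rule Q.state_exists)
  define t where "t x = s (rep I x)" for x
  have t: "0 \<le> t x" "t x \<le> 1" if "x \<in> A" for x using that s by (simp_all add: t_def)
  have t_plus: "t (x \<boxplus> y) = min (t x + t y) 1" if "x \<in> A" "y \<in> A" for x y
    using that s_plus[of "rep I x" "rep I y"] by (simp add: t_def r)
  have t_minus: "t (x \<boxminus> y) = max (t x - t y) 0" if "x \<in> A" "y \<in> A" for x y
    using that s_minus[of "rep I x" "rep I y"] by (simp add: t_def r)
  \<comment> \<open>The kernel is an ideal above \<open>I\<close> that misses \<open>a\<close>,
    where the value is 1; maximality makes it equal to \<open>I\<close>.\<close>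
  define K where "K = {x \<in> A. t x = 0}"
  have t_bot: "t \<bottom> = 0" using t_minus[of \<bottom> \<bottom>] by simp
  have "ideal K"
    unfolding ideal_def
  proof (intro conjI ballI impI)
    show "\<bottom> \<in> K" using t_bot by (simp add: K_def)
    show "K \<subseteq> A" by (auto simp: K_def)
    fix x y assume x: "x \<in> K"
    show "x \<boxplus> y \<in> K" if "y \<in> K" using that x t_plus[of x y] by (simp add: K_def)
    show "y \<in> K" if "y \<in> A" "y \<sqsubseteq> x"
      using that x t_minus[of y x] t[of y] t_bot by (simp add: K_def le_def)
  qed
  moreover have "I \<subseteq> K"
  proof
    fix x assume x: "x \<in> I"
    then have "x \<in> A" using ideal_subset[OF iI] by blast
    then have "rep I x = rep I \<bottom>" using x r by simp
    then show "x \<in> K" using t_bot \<open>x \<in> A\<close> by (simp add: K_def t_def)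
  qed
  moreover have "a \<notin> K" using s(3) by (simp add: K_def t_def)
  then have "K \<noteq> A" using a(1) by blast
  ultimately have "K = I" using I by (auto simp: maximal_ideal_def)
  then have t_zero: "t x = 0 \<longleftrightarrow> x \<in> I" if "x \<in> A" for x using that by (auto simp: K_def)
  show ?thesis by (rule that) (fact t t_plus t_minus t_zero)+
qed

end

section \<open>EMV-algebras as hoops\<close>

text \<open>The difference is the product of \<open>x\<close> with the complement of
  \<open>y\<close>, written with \<open>plus\<close> by De Morgan. The Lukasiewicz axiom serves
  twice: at \<open>x\<close>, \<open>y\<close> it is \<open>sup_comm\<close>, at their complements
  it is \<open>inf_comm\<close>.\<close>

lemma (in mv_algebra) dual_wajsberg_hoop:
  assumes "neg zero = one"
  shows "dual_wajsberg_hoop A plus (\<lambda>x y. neg (plus (neg x) y)) zero"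
proof -
  interpret C: comm_monoid "\<lparr>carrier = A, mult = plus, one = zero\<rparr>" by (rule comm_monoid)
  note C = C.m_closed[simplified] C.one_closed[simplified] C.m_assoc[simplified]
    C.r_one[simplified] C.l_one[simplified]
  have comm: "plus x y = plus y x" if "x \<in> A" "y \<in> A" for x y
    using C.m_comm that by simp
  have neg_one: "neg one = zero" using neg_neg[of zero] assms C by simp
  \<comment> \<open>In the Lukasiewicz axiom for \<open>x\<close> and \<open>one\<close>, one side
    collapses to the sum of \<open>x\<close> and its complement, while the other starts with the
    absorbing \<open>one\<close>.\<close>
  have plus_neg: "plus (neg x) x = one" if "x \<in> A" for x
    using lukasiewicz[of x one] plus_one[of "neg (plus one (neg x))"] that neg_one C
      comm[of x "neg x"] comm[of one "neg (plus one (neg x))"] neg_closed one_closed by simp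
  show ?thesis
  proof unfold_locales
    fix x y assume [simp]: "x \<in> A" "y \<in> A"
    show "plus x y = plus y x" by (rule comm) simp_all
    show "neg (plus (neg zero) x) = zero"
      using assms plus_one[of x] comm[of x one] one_closed neg_one by simp
    show "plus (neg (plus (neg x) y)) y = plus (neg (plus (neg y) x)) x"
      using lukasiewicz[of x y] comm[of x "neg y"] comm[of y "neg x"]
        comm[of x "neg (plus (neg y) x)"] comm[of y "neg (plus (neg x) y)"] neg_closed C
      by simp
    show "neg (plus (neg x) (neg (plus (neg x) y))) = neg (plus (neg y) (neg (plus (neg y) x)))"
      using lukasiewicz[of "neg x" "neg y"] neg_closed neg_neg by simp
  qed (simp_all add: C neg_closed neg_neg plus_neg neg_one)
qed

context emv_algebra
begin

section \<open>Order and idempotents of an EMV-algebra\<close>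

lemma oplus_closed [simp, intro]: "\<lbrakk>x \<in> carrier M; y \<in> carrier M\<rbrakk> \<Longrightarrow> x \<oplus> y \<in> carrier M"
  and bottom_closed [simp, intro]: "\<zero> \<in> carrier M"
  and oplus_assoc: "\<lbrakk>x \<in> carrier M; y \<in> carrier M; z \<in> carrier M\<rbrakk> \<Longrightarrow>
    (x \<oplus> y) \<oplus> z = x \<oplus> (y \<oplus> z)"
  and oplus_comm: "\<lbrakk>x \<in> carrier M; y \<in> carrier M\<rbrakk> \<Longrightarrow> x \<oplus> y = y \<oplus> x"
  and oplus_bottom [simp]: "x \<in> carrier M \<Longrightarrow> x \<oplus> \<zero> = x" "x \<in> carrier M \<Longrightarrow> \<zero> \<oplus> x = x"
proof -
  interpret C: comm_monoid "\<lparr>carrier = carrier M, mult = (\<oplus>), one = \<zero>\<rparr>" by (rule comm_monoid)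
  show "\<lbrakk>x \<in> carrier M; y \<in> carrier M\<rbrakk> \<Longrightarrow> x \<oplus> y \<in> carrier M" using C.m_closed by simp
  show "\<zero> \<in> carrier M" using C.one_closed by simp
  show "\<lbrakk>x \<in> carrier M; y \<in> carrier M; z \<in> carrier M\<rbrakk> \<Longrightarrow>
    (x \<oplus> y) \<oplus> z = x \<oplus> (y \<oplus> z)" using C.m_assoc by simp
  show "\<lbrakk>x \<in> carrier M; y \<in> carrier M\<rbrakk> \<Longrightarrow> x \<oplus> y = y \<oplus> x" using C.m_comm by simp
  show "x \<in> carrier M \<Longrightarrow> x \<oplus> \<zero> = x" using C.r_one by simp
  show "x \<in> carrier M \<Longrightarrow> \<zero> \<oplus> x = x" using C.l_one by simp
qed

lemma emv_le_refl [simp]: "x \<in> carrier M \<Longrightarrow> x \<preceq> x"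
  using vee_absorb[of x x] wedge_absorb[of x "x \<curlywedge> x"] wedge_closed[of x x]
  by (simp add: emv_le_def)

lemma emv_le_antisym: "\<lbrakk>x \<preceq> y; y \<preceq> x; x \<in> carrier M; y \<in> carrier M\<rbrakk> \<Longrightarrow> x = y"
  using wedge_comm[of x y] by (simp add: emv_le_def)

lemma emv_le_trans [trans]:
  "\<lbrakk>x \<preceq> y; y \<preceq> z; x \<in> carrier M; y \<in> carrier M; z \<in> carrier M\<rbrakk> \<Longrightarrow> x \<preceq> z"
  using wedge_assoc[of x y z] by (simp add: emv_le_def)

lemma wedge_lower1: "\<lbrakk>x \<in> carrier M; y \<in> carrier M\<rbrakk> \<Longrightarrow> x \<curlywedge> y \<preceq> x"
  using wedge_assoc[of x x y] wedge_comm[of "x \<curlywedge> y" x] wedge_closed[of x y] emv_le_refl[of x]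
  by (simp add: emv_le_def)

lemma wedge_lower2: "\<lbrakk>x \<in> carrier M; y \<in> carrier M\<rbrakk> \<Longrightarrow> x \<curlywedge> y \<preceq> y"
  using wedge_lower1[of y x] by (simp add: wedge_comm)

lemma wedge_greatest:
  "\<lbrakk>z \<preceq> x; z \<preceq> y; x \<in> carrier M; y \<in> carrier M; z \<in> carrier M\<rbrakk> \<Longrightarrow> z \<preceq> x \<curlywedge> y"
  using wedge_assoc[of z x y] by (simp add: emv_le_def)

lemma vee_upper1: "\<lbrakk>x \<in> carrier M; y \<in> carrier M\<rbrakk> \<Longrightarrow> x \<preceq> x \<curlyvee> y"
  by (simp add: emv_le_def wedge_absorb)

lemma vee_upper2: "\<lbrakk>x \<in> carrier M; y \<in> carrier M\<rbrakk> \<Longrightarrow> y \<preceq> x \<curlyvee> y"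
  using vee_upper1[of y x] by (simp add: vee_comm)

lemma vee_least:
  "\<lbrakk>x \<preceq> z; y \<preceq> z; x \<in> carrier M; y \<in> carrier M; z \<in> carrier M\<rbrakk> \<Longrightarrow> x \<curlyvee> y \<preceq> z"
  using distrib[of z x y] wedge_comm[of z x] wedge_comm[of z y] wedge_comm[of "x \<curlyvee> y" z]
    vee_closed[of x y]
  by (simp add: emv_le_def)

lemma le_oplus: "\<lbrakk>x \<in> carrier M; y \<in> carrier M\<rbrakk> \<Longrightarrow> x \<preceq> x \<oplus> y"
  using oplus_mono[of \<zero> y x] bot_least[of y] oplus_comm[of x y] by simp

lemma oplus_mono2:
  assumes "x \<preceq> y" "z \<preceq> w" and [simp]: "x \<in> carrier M" "y \<in> carrier M" "z \<in> carrier M" "w \<in> carrier M"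
  shows "x \<oplus> z \<preceq> y \<oplus> w"
proof -
  have "x \<oplus> z \<preceq> y \<oplus> z" using assms by (simp add: oplus_mono)
  also have "y \<oplus> z \<preceq> y \<oplus> w" using oplus_mono[of z w y] assms by (simp add: oplus_comm)
  finally show ?thesis by simp
qed

lemma idempotentsD: "b \<in> idempotents M \<Longrightarrow> b \<in> carrier M" "b \<in> idempotents M \<Longrightarrow> b \<oplus> b = b"
  by (simp_all add: idempotents_def)

lemma bottom_idempotent: "\<zero> \<in> idempotents M"
  by (simp add: idempotents_def)

lemma oplus_idempotent:
  assumes "a \<in> idempotents M" "b \<in> idempotents M"
  shows "a \<oplus> b \<in> idempotents M"
proof -
  have [simp]: "a \<in> carrier M" "b \<in> carrier M" using assms idempotentsD by auto
  have "(a \<oplus> b) \<oplus> (a \<oplus> b) = a \<oplus> ((b \<oplus> a) \<oplus> b)" by (simp add: oplus_assoc)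
  also have "\<dots> = a \<oplus> ((a \<oplus> b) \<oplus> b)" using oplus_comm[of a b] by simp
  also have "\<dots> = (a \<oplus> a) \<oplus> (b \<oplus> b)" by (simp add: oplus_assoc)
  finally show ?thesis using assms by (simp add: idempotents_def)
qed

lemma common_idempotent:
  assumes "x \<in> carrier M" "y \<in> carrier M"
  obtains b where "b \<in> idempotents M" "x \<preceq> b" "y \<preceq> b"
proof -
  obtain a b where ab: "a \<in> idempotents M" "x \<preceq> a" "b \<in> idempotents M" "y \<preceq> b"
    using below_idempotent assms by meson
  then have [simp]: "a \<in> carrier M" "b \<in> carrier M" using idempotentsD by auto
  have "x \<preceq> a \<oplus> b" using emv_le_trans[OF ab(2) le_oplus[of a b]] assms by simp
  moreover have "y \<preceq> a \<oplus> b"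
    using emv_le_trans[OF ab(4) le_oplus[of b a]] assms oplus_comm[of a b] by simp
  ultimately show ?thesis using that[of "a \<oplus> b"] ab oplus_idempotent by blast
qed

lemma common_idempotent3:
  assumes "x \<in> carrier M" "y \<in> carrier M" "z \<in> carrier M"
  obtains b where "b \<in> idempotents M" "x \<preceq> b" "y \<preceq> b" "z \<preceq> b"
proof -
  obtain a where a: "a \<in> idempotents M" "x \<preceq> a" "y \<preceq> a"
    using common_idempotent[OF assms(1,2)] .
  obtain b where b: "b \<in> idempotents M" "a \<preceq> b" "z \<preceq> b"
    using common_idempotent[OF idempotentsD(1)[OF a(1)] assms(3)] .
  have "x \<preceq> b" "y \<preceq> b"
    using emv_le_trans[OF a(2) b(2)] emv_le_trans[OF a(3) b(2)] assms a(1) b(1) idempotentsD by auto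
  then show ?thesis using that b by blast
qed

abbreviation lam :: "'a \<Rightarrow> 'a \<Rightarrow> 'a"
  where "lam b x \<equiv> emv_lambda M \<zero> b x"

abbreviation below :: "'a \<Rightarrow> 'a set"
  where "below b \<equiv> emv_interval M \<zero> b"

lemma below_iff: "x \<in> below b \<longleftrightarrow> x \<in> carrier M \<and> x \<preceq> b"
  using bot_least by (auto simp: emv_interval_def)

lemma emv_lambda_eqI:
  assumes "is_emv_min M (emv_complements M a b x) z"
  shows "emv_lambda M a b x = z"
  unfolding emv_lambda_def
proof (rule the_equality)
  show "w = z" if "is_emv_min M (emv_complements M a b x) w" for w
    using that assms by (auto simp: is_emv_min_def emv_complements_def emv_interval_def
      intro: emv_le_antisym)
qed (fact assms)

section \<open>The truncated difference inside one interval\<close>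

context
  fixes b
  assumes b: "b \<in> idempotents M"
begin

interpretation mv: mv_algebra "below b" "(\<oplus>)" "lam b" \<zero> b
  using b by (intro interval_mv) (simp_all add: bottom_idempotent bot_least idempotentsD)

lemma lam_min: "x \<in> below b \<Longrightarrow> is_emv_min M (emv_complements M \<zero> b x) (lam b x)"
  using lambda_exists[OF bottom_idempotent b] bot_least[OF idempotentsD(1)[OF b]] emv_lambda_eqI
  by metis

lemma lam_closed: "x \<in> below b \<Longrightarrow> lam b x \<in> below b"
  by (rule mv.neg_closed)

lemma lam_lam: "x \<in> below b \<Longrightarrow> lam b (lam b x) = x"
  by (rule mv.neg_neg)

lemma oplus_lam: "x \<in> below b \<Longrightarrow> x \<oplus> lam b x = b"
  using lam_min by (auto simp: is_emv_min_def emv_complements_def)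

lemma lam_least: "\<lbrakk>x \<in> below b; z \<in> below b; x \<oplus> z = b\<rbrakk> \<Longrightarrow> lam b x \<preceq> z"
  using lam_min by (auto simp: is_emv_min_def emv_complements_def)

lemma below_zero: "\<zero> \<in> below b" and below_top: "b \<in> below b"
  using b by (simp_all add: below_iff idempotentsD bot_least)

lemma lam_zero: "lam b \<zero> = b"
  using oplus_lam[OF below_zero] lam_closed[OF below_zero] by (simp add: below_iff)

lemma lam_top: "lam b b = \<zero>"
  using lam_lam[OF below_zero] by (simp add: lam_zero)

lemma below_oplus:
  assumes "x \<in> below b" "y \<in> below b"
  shows "x \<oplus> y \<in> below b"
  using assms oplus_mono2[of x b y b] b by (simp add: below_iff idempotentsD)

definition bminus :: "'a \<Rightarrow> 'a \<Rightarrow> 'a"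
  where "bminus x y = lam b (lam b x \<oplus> y)"

lemma bminus_hoop: "dual_wajsberg_hoop (below b) (\<oplus>) bminus \<zero>"
  using mv.dual_wajsberg_hoop[OF lam_zero] by (simp add: bminus_def[abs_def])

text \<open>Links the order of the hoop to that of the lattice. A vanishing difference says that
  \<open>y\<close> complements \<open>lam b x\<close> to \<open>b\<close>; minimality of
  \<open>\<lambda>\<close> then puts \<open>lam b (lam b x) = x\<close> below \<open>y\<close>. The
  converse uses monotonicity of \<open>\<oplus>\<close>.\<close>

lemma bminus_eq_zero_iff:
  assumes "x \<in> below b" "y \<in> below b"
  shows "bminus x y = \<zero> \<longleftrightarrow> x \<preceq> y"
proof -
  have [simp]: "x \<in> carrier M" "y \<in> carrier M" "b \<in> carrier M" "lam b x \<in> carrier M"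
    using assms b idempotentsD lam_closed by (auto simp: below_iff)
  have mem: "lam b x \<oplus> y \<in> below b" using assms by (simp add: below_oplus lam_closed)
  have "bminus x y = \<zero> \<longleftrightarrow> lam b x \<oplus> y = b"
    using lam_lam[OF mem] lam_zero lam_top by (auto simp: bminus_def)
  also have "\<dots> \<longleftrightarrow> x \<preceq> y"
  proof
    assume "lam b x \<oplus> y = b"
    then show "x \<preceq> y" using lam_least[of "lam b x" y] lam_lam assms lam_closed by simp
  next
    assume "x \<preceq> y"
    then have "x \<oplus> lam b x \<preceq> lam b x \<oplus> y"
      using oplus_mono[of x y "lam b x"] by (simp add: oplus_comm)
    then have "b \<preceq> lam b x \<oplus> y" using oplus_lam assms by simp
    then show "lam b x \<oplus> y = b" using mem by (auto simp: below_iff intro: emv_le_antisym)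
  qed
  finally show ?thesis .
qed

lemma bminus_closed: "\<lbrakk>x \<in> below b; y \<in> below b\<rbrakk> \<Longrightarrow> bminus x y \<in> below b"
  by (simp add: bminus_def below_oplus lam_closed)

lemma bminus_residuation:
  assumes "x \<in> below b" "y \<in> below b" "z \<in> below b"
  shows "bminus x y \<preceq> z \<longleftrightarrow> x \<preceq> y \<oplus> z"
proof -
  interpret H: dual_wajsberg_hoop "below b" "(\<oplus>)" bminus \<zero> by (rule bminus_hoop)
  show ?thesis
    using H.residuation[OF assms] assms
    by (simp add: H.le_def bminus_eq_zero_iff bminus_closed below_oplus)
qed

end

text \<open>Residuation characterizes the difference as the least \<open>z\<close> with
  \<open>x \<preceq> y \<oplus> z\<close>, a condition in which the bound does not occur.\<close>

lemma bminus_coherent: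
  assumes b: "b \<in> idempotents M" and c: "c \<in> idempotents M" and bc: "b \<preceq> c"
    and x: "x \<in> below b" and y: "y \<in> below b"
  shows "bminus b x y = bminus c x y"
proof -
  have sub: "z \<in> below c" if "z \<in> below b" for z
    using that emv_le_trans[OF _ bc] b c by (auto simp: below_iff idempotentsD)
  have xc: "x \<in> below c" and yc: "y \<in> below c" using x y sub by auto
  have xM: "x \<in> carrier M" "y \<in> carrier M" using x y by (auto simp: below_iff)
  have cM: "bminus c x y \<in> carrier M" using bminus_closed[OF c xc yc] by (simp add: below_iff)
  \<comment> \<open>Residuation with \<open>x\<close> itself as the candidate shows that the
    difference formed below \<open>c\<close> already lies below \<open>b\<close>.\<close>
  have "x \<preceq> y \<oplus> x" using le_oplus[of x y] xM by (simp add: oplus_comm)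
  then have "bminus c x y \<preceq> x" using bminus_residuation[OF c xc yc xc] by simp
  then have d: "bminus c x y \<in> below b"
    using x emv_le_trans[of _ x b] cM b by (auto simp: below_iff idempotentsD)
  have e: "bminus b x y \<in> below b" by (rule bminus_closed[OF b x y])
  have "x \<preceq> y \<oplus> bminus c x y" using bminus_residuation[OF c xc yc sub[OF d]] cM by simp
  then have 1: "bminus b x y \<preceq> bminus c x y" using bminus_residuation[OF b x y d] by simp
  have "x \<preceq> y \<oplus> bminus b x y" using bminus_residuation[OF b x y e] e by (simp add: below_iff)
  then have "bminus c x y \<preceq> bminus b x y" using bminus_residuation[OF c xc yc sub[OF e]] by simp
  then show ?thesis using 1 d e by (auto simp: below_iff intro: emv_le_antisym)
qed

section \<open>The global difference\<close>

definition diff :: "'a \<Rightarrow> 'a \<Rightarrow> 'a"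
  where "diff x y = bminus (SOME b. b \<in> idempotents M \<and> x \<preceq> b \<and> y \<preceq> b) x y"

text \<open>Two bounding idempotents may be incomparable; each is compared with a third one above
  both.\<close>

lemma diff_eq:
  assumes b: "b \<in> idempotents M" and x: "x \<in> below b" and y: "y \<in> below b"
  shows "diff x y = bminus b x y"
proof -
  define c where "c = (SOME b. b \<in> idempotents M \<and> x \<preceq> b \<and> y \<preceq> b)"
  have "c \<in> idempotents M \<and> x \<preceq> c \<and> y \<preceq> c"
    unfolding c_def by (rule someI[of _ b]) (use assms in \<open>simp add: below_iff\<close>)
  then have c: "c \<in> idempotents M" "x \<in> below c" "y \<in> below c"
    using x y by (auto simp: below_iff)
  obtain d where d: "d \<in> idempotents M" "b \<preceq> d" "c \<preceq> d"
    using common_idempotent b c(1) idempotentsD(1) by metis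
  have "diff x y = bminus c x y" by (simp add: diff_def c_def)
  also have "\<dots> = bminus d x y" by (rule bminus_coherent) (use c d in auto)
  also have "\<dots> = bminus b x y" by (rule bminus_coherent[symmetric]) (use assms d in auto)
  finally show ?thesis .
qed

text \<open>Three elements always share a bounding idempotent, which suffices for every
  axiom.\<close>

lemma diff_hoop: "dual_wajsberg_hoop (carrier M) (\<oplus>) diff \<zero>"
proof -
  have ex: "\<exists>b. b \<in> idempotents M \<and> x \<in> below b \<and> y \<in> below b \<and> z \<in> below b"
    if "x \<in> carrier M" "y \<in> carrier M" "z \<in> carrier M" for x y z
    using common_idempotent3[OF that] that by (metis below_iff)
  have sub: "x \<in> carrier M" if "x \<in> below b" for x b using that by (simp add: below_iff)
  show ?thesis
  proof
    fix x y z assume xyz: "x \<in> carrier M" "y \<in> carrier M" "z \<in> carrier M"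
    obtain b where b: "b \<in> idempotents M" and m: "x \<in> below b" "y \<in> below b" "z \<in> below b"
      using ex[OF xyz] by blast
    interpret H: dual_wajsberg_hoop "below b" "(\<oplus>)" "bminus b" \<zero> by (rule bminus_hoop[OF b])
    show "diff x (y \<oplus> z) = diff (diff x y) z"
      using H.minus_plus m by (simp add: diff_eq[OF b])
  next
    fix x y assume xy: "x \<in> carrier M" "y \<in> carrier M"
    obtain b where b: "b \<in> idempotents M" and m: "x \<in> below b" "y \<in> below b"
      using ex[OF xy(1) xy] by blast
    interpret H: dual_wajsberg_hoop "below b" "(\<oplus>)" "bminus b" \<zero> by (rule bminus_hoop[OF b])
    show "diff x y \<in> carrier M" using m H.minus_closed[THEN sub] by (simp add: diff_eq[OF b])
    show "diff x x = \<zero>" using m by (simp add: diff_eq[OF b])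
    show "diff \<zero> x = \<zero>" using m by (simp add: diff_eq[OF b])
    show "diff x y \<oplus> y = diff y x \<oplus> x" using m H.sup_comm by (simp add: diff_eq[OF b])
    show "diff x (diff x y) = diff y (diff y x)" using m H.inf_comm by (simp add: diff_eq[OF b])
    show "x \<oplus> y = y \<oplus> x" using xy by (rule oplus_comm)
  qed (simp_all add: oplus_assoc)
qed

sublocale hoop: dual_wajsberg_hoop "carrier M" "(\<oplus>)" diff \<zero>
  by (rule diff_hoop)

lemma hoop_le_iff:
  assumes "x \<in> carrier M" "y \<in> carrier M"
  shows "hoop.le x y \<longleftrightarrow> x \<preceq> y"
proof -
  obtain b where b: "b \<in> idempotents M" "x \<preceq> b" "y \<preceq> b" using common_idempotent[OF assms] .
  then have "x \<in> below b" "y \<in> below b" using assms by (auto simp: below_iff)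
  then show ?thesis using b by (simp add: hoop.le_def diff_eq bminus_eq_zero_iff)
qed

lemma lam_eq_diff:
  assumes "b \<in> idempotents M" "x \<in> below b"
  shows "lam b x = diff b x"
  using diff_eq[OF assms(1) below_top[OF assms(1)] assms(2)] assms
  by (simp add: bminus_def lam_top below_iff)

text \<open>With \<open>vee_eq_diff\<close> this makes the lattice operations terms in
  \<open>\<oplus>\<close> and \<open>diff\<close>, so the real-valued maps built from the hoop alone
  also respect meet and join.\<close>

lemma wedge_eq_diff:
  assumes [simp]: "x \<in> carrier M" "y \<in> carrier M"
  shows "x \<curlywedge> y = diff x (diff x y)"
proof (rule emv_le_antisym)
  have [simp]: "x \<curlywedge> y \<in> carrier M" by (simp add: wedge_closed)
  show "x \<curlywedge> y \<preceq> diff x (diff x y)"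
    using hoop.inf_greatest[of "x \<curlywedge> y" x y] by (simp add: hoop_le_iff wedge_lower1 wedge_lower2)
  show "diff x (diff x y) \<preceq> x \<curlywedge> y"
    using hoop.minus_le[of x "diff x y"] hoop.minus_minus_le[of x y]
    by (simp add: hoop_le_iff wedge_greatest del: hoop.minus_le)
qed (simp_all add: wedge_closed)

lemma vee_eq_diff:
  assumes [simp]: "x \<in> carrier M" "y \<in> carrier M"
  shows "x \<curlyvee> y = diff x y \<oplus> y"
proof (rule emv_le_antisym)
  have [simp]: "x \<curlyvee> y \<in> carrier M" by (simp add: vee_closed)
  show "diff x y \<oplus> y \<preceq> x \<curlyvee> y"
    using hoop.sup_least[of x "x \<curlyvee> y" y] by (simp add: hoop_le_iff vee_upper1 vee_upper2)
  have "x \<preceq> diff x y \<oplus> y"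
    using hoop.le_minus_add[of x y] by (simp add: hoop_le_iff oplus_comm[of y])
  moreover have "y \<preceq> diff x y \<oplus> y" using le_oplus[of y "diff x y"] by (simp add: oplus_comm[of y])
  ultimately show "x \<curlyvee> y \<preceq> diff x y \<oplus> y" by (simp add: vee_least)
qed (simp_all add: vee_closed)

section \<open>Ideals of the EMV-algebra and of its hoop\<close>

lemma emv_ideal_iff: "emv_ideal M I \<longleftrightarrow> hoop.ideal I"
proof
  assume I: "emv_ideal M I"
  then obtain x where "x \<in> I" "x \<in> carrier M" by (auto simp: emv_ideal_def)
  then have "\<zero> \<in> I" using I bot_least by (auto simp: emv_ideal_def)
  then show "hoop.ideal I"
    using I hoop_le_iff unfolding emv_ideal_def hoop.ideal_def by blast
next
  assume "hoop.ideal I"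
  then show "emv_ideal M I"
    using hoop_le_iff unfolding emv_ideal_def hoop.ideal_def by blast
qed

lemma maximal_emv_ideal_imp_hoop:
  assumes "maximal_emv_ideal M I"
  shows "hoop.maximal_ideal I"
  unfolding hoop.maximal_ideal_def
proof (intro conjI allI impI)
  show "hoop.ideal I" "I \<noteq> carrier M"
    using assms by (auto simp: maximal_emv_ideal_def emv_ideal_iff)
  fix J assume J: "hoop.ideal J" "I \<subseteq> J"
  show "J = I \<or> J = carrier M"
  proof (cases "J = I")
    case False
    then obtain x where x: "x \<in> J" "x \<notin> I" using J by blast
    then have xM: "x \<in> carrier M" using J hoop.ideal_subset by blast
    have "generated_ideal M (I \<union> {x}) \<subseteq> J"
      unfolding generated_ideal_def using J x by (intro Inter_lower) (auto simp: emv_ideal_iff)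
    moreover have "generated_ideal M (I \<union> {x}) = carrier M"
      using assms x xM by (auto simp: maximal_emv_ideal_def)
    ultimately show ?thesis using J hoop.ideal_subset by blast
  qed simp
qed

end

section \<open>Representation by fuzzy sets\<close>

context emv_algebra
begin

definition is_state :: "'a set \<Rightarrow> ('a \<Rightarrow> real) \<Rightarrow> bool"
  where "is_state I s \<longleftrightarrow>
    (\<forall>x\<in>carrier M. 0 \<le> s x \<and> s x \<le> 1 \<and> (s x = 0 \<longleftrightarrow> x \<in> I)) \<and>
    (\<forall>x\<in>carrier M. \<forall>y\<in>carrier M.
      s (x \<oplus> y) = min (s x + s y) 1 \<and> s (diff x y) = max (s x - s y) 0)"

text \<open>Supplies the top of the quotient by \<open>I\<close> and, later, the element with value
  1 at the point \<open>I\<close> that a clan must contain.\<close>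

lemma idempotent_outside:
  assumes "maximal_emv_ideal M I"
  obtains b where "b \<in> idempotents M" "b \<notin> I"
proof -
  have I: "emv_ideal M I" "I \<noteq> carrier M" using assms by (auto simp: maximal_emv_ideal_def)
  then obtain x where x: "x \<in> carrier M" "x \<notin> I" by (auto simp: emv_ideal_def)
  then obtain b where b: "b \<in> idempotents M" "x \<preceq> b" using below_idempotent by blast
  then have "b \<notin> I" using x I by (auto simp: emv_ideal_def)
  then show ?thesis using that b by blast
qed

lemma is_state_exists:
  assumes I: "maximal_emv_ideal M I"
  shows "\<exists>s. is_state I s"
proof -
  obtain b where b: "b \<in> idempotents M" "b \<notin> I" using idempotent_outside[OF I] .
  obtain s where "\<And>x. x \<in> carrier M \<Longrightarrow> 0 \<le> s x" "\<And>x. x \<in> carrier M \<Longrightarrow> s x \<le> (1 :: real)"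
      "\<And>x y. \<lbrakk>x \<in> carrier M; y \<in> carrier M\<rbrakk> \<Longrightarrow> s (x \<oplus> y) = min (s x + s y) 1"
      "\<And>x y. \<lbrakk>x \<in> carrier M; y \<in> carrier M\<rbrakk> \<Longrightarrow> s (diff x y) = max (s x - s y) 0"
      "\<And>x. x \<in> carrier M \<Longrightarrow> s x = 0 \<longleftrightarrow> x \<in> I"
    using that by (rule hoop.maximal_ideal_state[OF maximal_emv_ideal_imp_hoop[OF I]
        idempotentsD(1)[OF b(1)] b(2) idempotentsD(2)[OF b(1)]])
  then have "is_state I s" by (simp add: is_state_def)
  then show ?thesis by (rule exI[of _ s])
qed

definition state :: "'a set \<Rightarrow> 'a \<Rightarrow> real"
  where "state I = (SOME s. is_state I s)"

definition max_spec :: "'a set set"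
  where "max_spec = {I. maximal_emv_ideal M I}"

text \<open>The analogue of the Gelfand transform.\<close>

definition transform :: "'a \<Rightarrow> 'a set \<Rightarrow> real"
  where "transform x = (\<lambda>I\<in>max_spec. state I x)"

lemma is_state_state: "I \<in> max_spec \<Longrightarrow> is_state I (state I)"
  unfolding state_def max_spec_def by (rule someI_ex[of "is_state I"], rule is_state_exists) simp

context
  fixes I
  assumes I: "I \<in> max_spec"
begin

lemma state_nonneg: "x \<in> carrier M \<Longrightarrow> 0 \<le> state I x"
  and state_le_one: "x \<in> carrier M \<Longrightarrow> state I x \<le> 1"
  and state_eq_zero_iff: "x \<in> carrier M \<Longrightarrow> state I x = 0 \<longleftrightarrow> x \<in> I"
  and state_oplus: "\<lbrakk>x \<in> carrier M; y \<in> carrier M\<rbrakk> \<Longrightarrow> state I (x \<oplus> y) = min (state I x + state I y) 1"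
  and state_diff: "\<lbrakk>x \<in> carrier M; y \<in> carrier M\<rbrakk> \<Longrightarrow> state I (diff x y) = max (state I x - state I y) 0"
  using is_state_state[OF I] unfolding is_state_def by blast+

lemma state_bottom: "state I \<zero> = 0"
  using state_diff[of \<zero> \<zero>] by simp

text \<open>The truncation in \<open>state_oplus\<close> is invisible here, since the untruncated
  sum is the larger of two values that are at most 1.\<close>

lemma state_vee:
  "\<lbrakk>x \<in> carrier M; y \<in> carrier M\<rbrakk> \<Longrightarrow> state I (x \<curlyvee> y) = max (state I x) (state I y)"
  using state_le_one[of x] state_le_one[of y]
  by (simp add: vee_eq_diff state_oplus state_diff min_def max_def)

lemma state_wedge:
  "\<lbrakk>x \<in> carrier M; y \<in> carrier M\<rbrakk> \<Longrightarrow> state I (x \<curlywedge> y) = min (state I x) (state I y)"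
  using state_nonneg[of x] state_nonneg[of y]
  by (simp add: wedge_eq_diff state_diff min_def max_def)

lemma state_mono: "\<lbrakk>x \<preceq> y; x \<in> carrier M; y \<in> carrier M\<rbrakk> \<Longrightarrow> state I x \<le> state I y"
  using state_wedge[of x y] by (simp add: emv_le_def)

lemma state_idempotent: "b \<in> idempotents M \<Longrightarrow> state I b = 0 \<or> state I b = 1"
  using state_oplus[of b b] idempotentsD[of b] by (auto simp: min_def split: if_splits)

end

section \<open>The transform as an embedding into a clan\<close>

lemma characteristic_transform:
  assumes "b \<in> idempotents M"
  shows "characteristic_fun max_spec (transform b)"
  unfolding characteristic_fun_def transform_def
  using state_idempotent assms
  by (intro exI[of _ "{I \<in> max_spec. state I b = 1}"] conjI restrict_ext) auto

lemma transform_apply: "I \<in> max_spec \<Longrightarrow> transform x I = state I x"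
  by (simp add: transform_def)

lemma transform_eqI: "(\<And>I. I \<in> max_spec \<Longrightarrow> g I = state I x) \<Longrightarrow> (\<lambda>I\<in>max_spec. g I) = transform x"
  unfolding transform_def by (rule restrict_ext)

lemma emv_clan_transform:
  assumes "max_spec \<noteq> {}"
  shows "emv_clan max_spec (transform ` carrier M)"
proof
  show "max_spec \<noteq> {}" by fact
  show "transform ` carrier M \<subseteq> max_spec \<rightarrow>\<^sub>E {0..1}"
    by (auto simp: transform_def state_nonneg state_le_one)
  show "(\<lambda>I\<in>max_spec. 0) \<in> transform ` carrier M"
    by (intro image_eqI[where x = \<zero>] transform_eqI) (simp_all add: state_bottom)
next
  fix a f assume a: "a \<in> transform ` carrier M" and f: "f \<in> transform ` carrier M"
    and le: "\<forall>I\<in>max_spec. f I \<le> a I"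
  obtain x y where xy: "x \<in> carrier M" "y \<in> carrier M" "a = transform x" "f = transform y"
    using a f by blast
  show "(\<lambda>I\<in>max_spec. a I - f I) \<in> transform ` carrier M"
    by (intro image_eqI[where x = "diff x y"] transform_eqI)
      (use xy le in \<open>simp_all add: transform_apply state_diff\<close>)
next
  fix a f g assume a: "characteristic_fun max_spec a"
    and f: "f \<in> transform ` carrier M" "g \<in> transform ` carrier M"
    and le: "\<forall>I\<in>max_spec. f I \<le> a I \<and> g I \<le> a I"
  obtain x y where xy: "x \<in> carrier M" "y \<in> carrier M" "f = transform x" "g = transform y"
    using f by blast
  have "min (f I + g I) (a I) = state I (x \<oplus> y)" if I: "I \<in> max_spec" for I
  proof -
    have "a I = 0 \<or> a I = 1" using a I by (auto simp: characteristic_fun_def)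
    then show ?thesis
      using bspec[OF le I] xy I state_nonneg[OF I, of x] state_nonneg[OF I, of y]
      by (auto simp: transform_apply state_oplus)
  qed
  then show "(\<lambda>I\<in>max_spec. min (f I + g I) (a I)) \<in> transform ` carrier M"
    using xy by (intro image_eqI[where x = "x \<oplus> y"] transform_eqI) simp_all
next
  fix f assume "f \<in> transform ` carrier M"
  then obtain x where x: "x \<in> carrier M" "f = transform x" by blast
  then obtain b where b: "b \<in> idempotents M" "x \<preceq> b" using below_idempotent by blast
  show "\<exists>a\<in>transform ` carrier M. characteristic_fun max_spec a \<and> (\<forall>I\<in>max_spec. f I \<le> a I)"
    using x b idempotentsD characteristic_transform[OF b(1)]
    by (intro bexI[of _ "transform b"]) (auto simp: transform_apply state_mono)
next
  fix I assume I: "I \<in> max_spec"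
  then obtain b where b: "b \<in> idempotents M" "b \<notin> I"
    using idempotent_outside by (auto simp: max_spec_def)
  then have "state I b = 1"
    using state_idempotent[OF I b(1)] state_eq_zero_iff[OF I] idempotentsD by auto
  then show "\<exists>f\<in>transform ` carrier M. f I = 1"
    using b I idempotentsD by (intro bexI[of _ "transform b"]) (auto simp: transform_apply)
qed

text \<open>Equal transforms put the differences in both directions into every maximal ideal, hence
  into the intersection.\<close>

lemma inj_on_transform:
  assumes "\<Inter>max_spec = {\<zero>}"
  shows "inj_on transform (carrier M)"
proof (rule inj_onI)
  have le: "x \<preceq> y" if "transform x = transform y" "x \<in> carrier M" "y \<in> carrier M" for x y
  proof -
    have "diff x y \<in> I" if I: "I \<in> max_spec" for I
    proof -
      have "state I x = state I y"
        using \<open>transform x = transform y\<close> transform_apply[OF I] by metis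
      then have "state I (diff x y) = 0" using that \<open>x \<in> _\<close> \<open>y \<in> _\<close> by (simp add: state_diff)
      then show ?thesis using that \<open>x \<in> _\<close> \<open>y \<in> _\<close> by (simp add: state_eq_zero_iff)
    qed
    then have "diff x y = \<zero>" using assms by blast
    then show ?thesis using hoop_le_iff[of x y] that by (simp add: hoop.le_def)
  qed
  fix x y assume "x \<in> carrier M" "y \<in> carrier M" "transform x = transform y"
  then show "x = y" using le[of x y] le[of y x] by (simp add: emv_le_antisym)
qed

text \<open>The delicate operation is \<open>\<lambda>\<close>, in the clan a minimum over functions
  of the image only. Candidates are therefore described by elements \<open>z\<close> of
  \<open>M\<close> (\<open>mem\<close>); the pointwise lower bound b - x is attained because it is
  the transform of \<open>diff b x\<close>.\<close>

lemma transform_hom: "transform \<in> emv_hom M (clan_algebra max_spec (transform ` carrier M))"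
proof -
  let ?N = "clan_algebra max_spec (transform ` carrier M)"
  have "emv_lambda ?N \<zero>\<^bsub>?N\<^esub> (transform b) (transform x) = transform (lam b x)"
    if b: "b \<in> idempotents M" and x: "x \<in> below b" for b x
  proof -
    have bM [simp]: "b \<in> carrier M" "x \<in> carrier M" "x \<preceq> b"
      using b x idempotentsD by (auto simp: below_iff)
    have lam: "lam b x = diff b x" by (rule lam_eq_diff[OF b x])
    have le_iff: "f \<preceq>\<^bsub>?N\<^esub> g \<longleftrightarrow> (\<forall>I\<in>max_spec. f I \<le> g I)" if f: "f \<in> transform ` carrier M" for f g
    proof -
      obtain z where "f = transform z" using f by blast
      then have f: "restrict f max_spec = f" by (simp add: transform_def)
      show ?thesis
      proof
        assume "f \<preceq>\<^bsub>?N\<^esub> g"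
        then have e: "(\<lambda>I\<in>max_spec. min (f I) (g I)) = f" by (simp add: emv_le_def clan_algebra_def)
        show "\<forall>I\<in>max_spec. f I \<le> g I"
        proof
          fix I assume "I \<in> max_spec"
          then show "f I \<le> g I" using fun_cong[OF e, of I] by (simp add: min_def split: if_splits)
        qed
      next
        assume "\<forall>I\<in>max_spec. f I \<le> g I"
        then have "(\<lambda>I\<in>max_spec. min (f I) (g I)) = (\<lambda>I\<in>max_spec. f I)"
          by (intro restrict_ext) simp
        then show "f \<preceq>\<^bsub>?N\<^esub> g" using f by (simp add: emv_le_def clan_algebra_def)
      qed
    qed
    have carrier: "carrier ?N = transform ` carrier M" by (simp add: clan_algebra_def)
    have zero: "\<zero>\<^bsub>?N\<^esub> = transform \<zero>"
      by (simp add: clan_algebra_def transform_eqI state_bottom)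
    have le: "transform y \<preceq>\<^bsub>?N\<^esub> transform z \<longleftrightarrow> (\<forall>I\<in>max_spec. state I y \<le> state I z)"
      if "y \<in> carrier M" for y z
      using that by (simp add: le_iff transform_apply)
    have plus: "transform x \<oplus>\<^bsub>?N\<^esub> transform z = transform b \<longleftrightarrow>
        (\<forall>I\<in>max_spec. min (state I x + state I z) 1 = state I b)" for z
      by (auto simp: clan_algebra_def transform_def restrict_def fun_eq_iff)
    have mem: "f \<in> emv_complements ?N \<zero>\<^bsub>?N\<^esub> (transform b) (transform x) \<longleftrightarrow>
        (\<exists>z\<in>carrier M. f = transform z \<and> (\<forall>I\<in>max_spec. state I z \<le> state I b) \<and>
          (\<forall>I\<in>max_spec. min (state I x + state I z) 1 = state I b))" for f
      unfolding emv_complements_def emv_interval_def zero carrier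
      by (auto simp: le plus state_bottom state_nonneg)
    have min: "is_emv_min ?N (emv_complements ?N \<zero>\<^bsub>?N\<^esub> (transform b) (transform x)) (transform (lam b x))"
      unfolding is_emv_min_def
    proof (intro conjI ballI)
      show "transform (lam b x) \<in> emv_complements ?N \<zero>\<^bsub>?N\<^esub> (transform b) (transform x)"
        unfolding mem
        by (rule bexI[of _ "diff b x"])
          (auto simp: lam state_diff state_nonneg state_mono state_le_one)
    next
      fix f assume "f \<in> emv_complements ?N \<zero>\<^bsub>?N\<^esub> (transform b) (transform x)"
      then obtain z where z: "z \<in> carrier M" "f = transform z"
        "\<forall>I\<in>max_spec. min (state I x + state I z) 1 = state I b" unfolding mem by blast
      have "state I (diff b x) \<le> state I z" if "I \<in> max_spec" for I
        using bspec[OF z(3) that] state_nonneg[OF that z(1)] that by (auto simp: state_diff)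
      then show "transform (lam b x) \<preceq>\<^bsub>?N\<^esub> f" by (simp add: z le lam)
    qed
    \<comment> \<open>The target is not yet known to be an EMV-algebra, so the uniqueness behind
      \<open>THE\<close> comes from antisymmetry of the pointwise order on the image.\<close>
    show ?thesis
      unfolding emv_lambda_def[of ?N]
    proof (rule the_equality, rule min)
      fix f assume f: "is_emv_min ?N (emv_complements ?N \<zero>\<^bsub>?N\<^esub> (transform b) (transform x)) f"
      then obtain z where z: "z \<in> carrier M" "f = transform z"
        unfolding is_emv_min_def mem by blast
      have "f \<preceq>\<^bsub>?N\<^esub> transform (lam b x)" "transform (lam b x) \<preceq>\<^bsub>?N\<^esub> f"
        using f min by (auto simp: is_emv_min_def)
      then show "f = transform (lam b x)"
        unfolding z(2) lam using z(1)
        by (simp add: le) (auto simp: transform_def intro!: restrict_ext antisym)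
    qed
  qed
  moreover have "\<zero>\<^bsub>?N\<^esub> = transform \<zero>"
    by (simp add: clan_algebra_def transform_eqI state_bottom)
  moreover have "transform x \<curlyvee>\<^bsub>?N\<^esub> transform y = transform (x \<curlyvee> y)"
    "transform x \<curlywedge>\<^bsub>?N\<^esub> transform y = transform (x \<curlywedge> y)"
    "transform x \<oplus>\<^bsub>?N\<^esub> transform y = transform (x \<oplus> y)"
    if "x \<in> carrier M" "y \<in> carrier M" for x y
    using that
    by (auto simp: clan_algebra_def transform_apply state_vee state_wedge state_oplus
        intro!: transform_eqI)
  ultimately show ?thesis
    by (simp add: emv_hom_def) (simp add: clan_algebra_def)
qed

lemma clan_of_semisimple:
  assumes "semisimple M"
  shows "\<exists>(\<Omega> :: 'a set set) T. \<Omega> \<noteq> {} \<and> emv_clan \<Omega> T \<and> emv_isomorphic M (clan_algebra \<Omega> T)"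
proof -
  have ne: "max_spec \<noteq> {}" and Int: "\<Inter>max_spec = {\<zero>}"
    using assms by (simp_all add: semisimple_def max_spec_def)
  have "bij_betw transform (carrier M) (carrier (clan_algebra max_spec (transform ` carrier M)))"
    using inj_on_transform[OF Int] by (simp add: bij_betw_def clan_algebra_def)
  then have "emv_isomorphic M (clan_algebra max_spec (transform ` carrier M))"
    using transform_hom by (auto simp: emv_isomorphic_def)
  then show ?thesis using ne emv_clan_transform[OF ne] by blast
qed

section \<open>From clans back to semisimplicity\<close>

lemma carrier_ideal: "emv_ideal M (carrier M)"
  by (auto simp: emv_ideal_def)

text \<open>The elements whose function vanishes at \<omega> form a maximal ideal
  \<open>K \<omega>\<close>, and an element that lies in all of these has the zero function.
  Maximality rests on the archimedean property of the reals.\<close>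

lemma semisimple_of_clan:
  fixes \<Omega> :: "'w set"
  assumes clan: "emv_clan \<Omega> T" and iso: "emv_isomorphic M (clan_algebra \<Omega> T)"
  shows "semisimple M"
proof -
  interpret T: emv_clan \<Omega> T by fact
  obtain f where f: "f \<in> emv_hom M (clan_algebra \<Omega> T)" and bij: "bij_betw f (carrier M) T"
    using iso by (auto simp: emv_isomorphic_def clan_algebra_def)
  have fT: "f x \<in> T" if "x \<in> carrier M" for x using bij that by (auto simp: bij_betw_def)
  have surj: "\<exists>x\<in>carrier M. g = f x" if "g \<in> T" for g using bij that by (auto simp: bij_betw_def)
  have inj: "x = y" if "f x = f y" "x \<in> carrier M" "y \<in> carrier M" for x y
    using bij that by (auto simp: bij_betw_def inj_on_def)
  have T_eqI: "g = h" if "\<And>\<omega>. \<omega> \<in> \<Omega> \<Longrightarrow> g \<omega> = h \<omega>" "g \<in> T" "h \<in> T" for g h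
    using that T.fuzzy by (intro PiE_ext[of g \<Omega> _ h]) auto
  have bounds: "0 \<le> f x \<omega>" "f x \<omega> \<le> 1" if "x \<in> carrier M" "\<omega> \<in> \<Omega>" for x \<omega>
    using T.fuzzy fT[OF that(1)] that(2) by (auto dest!: subsetD PiE_mem)
  have plus: "f (x \<oplus> y) \<omega> = min (f x \<omega> + f y \<omega>) 1"
    and wedge: "f (x \<curlywedge> y) \<omega> = min (f x \<omega>) (f y \<omega>)"
    if "x \<in> carrier M" "y \<in> carrier M" "\<omega> \<in> \<Omega>" for x y \<omega>
    using f that by (simp_all add: emv_hom_def clan_algebra_def)
  have f_bot: "f \<zero> = (\<lambda>\<omega>\<in>\<Omega>. 0)"
    using f by (simp add: emv_hom_def clan_algebra_def)
  have mono: "f x \<omega> \<le> f y \<omega>" if "x \<preceq> y" "x \<in> carrier M" "y \<in> carrier M" "\<omega> \<in> \<Omega>" for x y \<omega>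
    using wedge[OF that(2-4)] that(1) by (simp add: emv_le_def)
  have idem: "f b \<omega> = 0 \<or> f b \<omega> = 1" if "b \<in> idempotents M" "\<omega> \<in> \<Omega>" for b \<omega>
    using plus[of b b \<omega>] that idempotentsD[of b] by (auto simp: min_def split: if_splits)
  \<comment> \<open>Clan differences are available only below characteristic functions; this makes
    them available below \<open>f b\<close>.\<close>
  have char: "characteristic_fun \<Omega> (f b)" if b: "b \<in> idempotents M" for b
  proof -
    have bM: "b \<in> carrier M" using b by (rule idempotentsD)
    then have "f b \<in> \<Omega> \<rightarrow>\<^sub>E {0..1}" using subsetD[OF T.fuzzy fT] by simp
    then have "restrict (f b) \<Omega> = f b" by (rule PiE_restrict)
    moreover have "restrict (f b) \<Omega> = (\<lambda>\<omega>\<in>\<Omega>. if \<omega> \<in> {\<omega>\<in>\<Omega>. f b \<omega> = 1} then 1 else 0)"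
      using idem[OF b] by (intro restrict_ext) auto
    ultimately show ?thesis
      unfolding characteristic_fun_def by (intro exI[of _ "{\<omega>\<in>\<Omega>. f b \<omega> = 1}"] conjI) auto
  qed
  define K where "K \<omega> = {x \<in> carrier M. f x \<omega> = 0}" for \<omega>
  have max: "maximal_emv_ideal M (K \<omega>)" if \<omega>: "\<omega> \<in> \<Omega>" for \<omega>
    unfolding maximal_emv_ideal_def
  proof (intro conjI ballI)
    show "emv_ideal M (K \<omega>)"
      unfolding emv_ideal_def
    proof (intro conjI ballI impI)
      show "K \<omega> \<noteq> {}" using f_bot \<omega> by (auto simp: K_def)
      show "K \<omega> \<subseteq> carrier M" by (auto simp: K_def)
      fix x y assume x: "x \<in> K \<omega>"
      show "y \<in> K \<omega>" if "y \<in> carrier M" "y \<preceq> x"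
        using that x mono[of y x \<omega>] bounds[of y \<omega>] \<omega> by (simp add: K_def)
      show "x \<oplus> y \<in> K \<omega>" if "y \<in> K \<omega>" using that x \<omega> by (simp add: K_def plus)
    qed
    show "K \<omega> \<noteq> carrier M"
    proof -
      obtain g where "g \<in> T" "g \<omega> = 1" using T.full \<omega> by blast
      then obtain x where "x \<in> carrier M" "f x \<omega> = 1" using surj by blast
      then have "x \<in> carrier M" "x \<notin> K \<omega>" by (simp_all add: K_def)
      then show ?thesis by blast
    qed
    fix x assume "x \<in> carrier M - K \<omega>"
    then have x: "x \<in> carrier M" "f x \<omega> > 0" using bounds[of x \<omega>] \<omega> by (auto simp: K_def)
    have "y \<in> J" if J: "emv_ideal M J" "K \<omega> \<union> {x} \<subseteq> J" and y: "y \<in> carrier M" for J y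
    proof -
      have sub: "J \<subseteq> carrier M" and down: "\<And>u v. \<lbrakk>u \<in> J; v \<in> carrier M; v \<preceq> u\<rbrakk> \<Longrightarrow> v \<in> J"
        and add: "\<And>u v. \<lbrakk>u \<in> J; v \<in> J\<rbrakk> \<Longrightarrow> u \<oplus> v \<in> J"
        using J(1) unfolding emv_ideal_def by blast+
      obtain b where b: "b \<in> idempotents M" "x \<preceq> b" "y \<preceq> b" using common_idempotent[OF x(1) y] .
      have bM: "b \<in> carrier M" using b idempotentsD by blast
      have fb: "f b \<omega> = 1" using idem[OF b(1) \<omega>] mono[OF b(2) x(1) bM \<omega>] x(2) by auto
      \<comment> \<open>Multiples of \<open>x\<close> stay below the idempotent \<open>b\<close>
        and, as \<open>f x \<omega> > 0\<close>, reach the value 1 at \<omega> for large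
        \<open>n\<close>. The bound \<open>b\<close> prepares the difference
        \<open>f b - f z\<close> in the clan.\<close>
      have "\<exists>z\<in>J. z \<preceq> b \<and> min (real n * f x \<omega>) 1 \<le> f z \<omega>" for n
      proof (induction n)
        case 0
        have "\<zero> \<in> J" using J f_bot \<omega> by (auto simp: K_def)
        then show ?case using bot_least[OF bM] bounds[of \<zero> \<omega>] \<omega> by (intro bexI[of _ \<zero>]) auto
      next
        case (Suc n)
        then obtain z where z: "z \<in> J" "z \<preceq> b" "min (real n * f x \<omega>) 1 \<le> f z \<omega>" by blast
        then have zM: "z \<in> carrier M" using sub by blast
        have "z \<oplus> x \<preceq> b"
          using oplus_mono2[OF z(2) b(2) zM bM x(1) bM] idempotentsD(2)[OF b(1)] by simp
        moreover have "min (real (Suc n) * f x \<omega>) 1 \<le> f (z \<oplus> x) \<omega>"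
          using z(3) x plus[OF zM x(1) \<omega>] by (simp add: algebra_simps min_def split: if_splits)
        moreover have "z \<oplus> x \<in> J" using add z(1) J(2) by blast
        ultimately show ?case by blast
      qed
      moreover obtain n :: nat where "real n * f x \<omega> > 1" using reals_Archimedean3[OF x(2)] by blast
      ultimately obtain z where z: "z \<in> J" "z \<preceq> b" "1 \<le> f z \<omega>" by (metis min.absorb2 less_imp_le)
      have zM: "z \<in> carrier M" using z sub by blast
      \<comment> \<open>Both functions are 1 at \<omega>, so the preimage \<open>w\<close> of their
        difference lies in \<open>K \<omega>\<close> and hence in \<open>J\<close>; then so does
        \<open>b = w \<oplus> z\<close>. Taking the difference by the clan axiom avoids computing
        \<open>emv_lambda\<close> in the clan.\<close>
      have "(\<lambda>\<omega>\<in>\<Omega>. f b \<omega> - f z \<omega>) \<in> T"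
        by (rule T.diff[OF fT[OF bM] char[OF b(1)] fT[OF zM]]) (use mono[OF z(2) zM bM] in blast)
      then obtain w where w: "w \<in> carrier M" "(\<lambda>\<omega>\<in>\<Omega>. f b \<omega> - f z \<omega>) = f w" using surj by blast
      have w': "f w \<nu> = f b \<nu> - f z \<nu>" if "\<nu> \<in> \<Omega>" for \<nu> using fun_cong[OF w(2), of \<nu>] that by simp
      have "f (w \<oplus> z) = f b"
        by (rule T_eqI) (use plus[OF w(1) zM] w' bounds[OF bM] fT w(1) zM bM in auto)
      then have "w \<oplus> z = b" using inj w(1) zM bM by blast
      moreover have "w \<in> K \<omega>"
        using w(1) w'[OF \<omega>] fb z(3) bounds(2)[OF zM \<omega>] by (simp add: K_def)
      ultimately have "b \<in> J" using add z(1) J(2) by blast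
      then show ?thesis using down y b(3) by blast
    qed
    then have "carrier M \<subseteq> generated_ideal M (K \<omega> \<union> {x})" unfolding generated_ideal_def by blast
    moreover have "generated_ideal M (K \<omega> \<union> {x}) \<subseteq> carrier M"
      unfolding generated_ideal_def using carrier_ideal x(1)
      by (intro Inter_lower) (auto simp: K_def)
    ultimately show "generated_ideal M (K \<omega> \<union> {x}) = carrier M" by blast
  qed
  have "\<Inter>{I. maximal_emv_ideal M I} \<subseteq> {\<zero>}"
  proof
    fix x assume x: "x \<in> \<Inter>{I. maximal_emv_ideal M I}"
    then have xK: "x \<in> K \<omega>" if "\<omega> \<in> \<Omega>" for \<omega> using max that by blast
    then have xM: "x \<in> carrier M" using T.nonempty by (auto simp: K_def)
    have "f x = f \<zero>"
      by (rule T_eqI) (use xK f_bot fT xM T.zero in \<open>auto simp: K_def\<close>)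
    then show "x \<in> {\<zero>}" using inj xM by simp
  qed
  moreover have "\<zero> \<in> I" if "maximal_emv_ideal M I" for I
    using that hoop.ideal_zero emv_ideal_iff by (auto simp: maximal_emv_ideal_def)
  moreover have "{I. maximal_emv_ideal M I} \<noteq> {}" using max T.nonempty by blast
  ultimately show ?thesis unfolding semisimple_def by blast
qed

end

text \<open>HOL formulas cannot quantify over types. The existence claim therefore fixes the type
  that the forward direction produces, with maximal ideals as points, and the second conjunct gives
  the converse for point sets of any type.\<close>

theorem theorem4p11:
  fixes M :: "'a emv"
  assumes "emv_algebra M"
  shows "(semisimple M \<longleftrightarrow>
           (\<exists>(\<Omega> :: 'a set set) T. \<Omega> \<noteq> {} \<and> emv_clan \<Omega> T \<and> emv_isomorphic M (clan_algebra \<Omega> T)))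
       \<and> (\<forall>(\<Omega> :: 'w set) T. \<Omega> \<noteq> {} \<and> emv_clan \<Omega> T \<and> emv_isomorphic M (clan_algebra \<Omega> T)
             \<longrightarrow> semisimple M)"
proof (intro conjI iffI allI impI)
  interpret emv_algebra M by fact
  show "\<exists>(\<Omega> :: 'a set set) T. \<Omega> \<noteq> {} \<and> emv_clan \<Omega> T \<and> emv_isomorphic M (clan_algebra \<Omega> T)"
    if "semisimple M" using that by (rule clan_of_semisimple)
  show "semisimple M"
    if "\<exists>(\<Omega> :: 'a set set) T. \<Omega> \<noteq> {} \<and> emv_clan \<Omega> T \<and> emv_isomorphic M (clan_algebra \<Omega> T)"
    using that semisimple_of_clan by blast
  show "semisimple M" if "\<Omega> \<noteq> {} \<and> emv_clan \<Omega> T \<and> emv_isomorphic M (clan_algebra \<Omega> T)"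
    for \<Omega> :: "'w set" and T
    using that semisimple_of_clan by blast
qed

end
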